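(* Let $K$ be a field, and let $R$ be a 0-dimensional affine $K$-algebra. Then the following conditions are equivalent. (a) The ring $R$ is locally Gorenstein. (b) The canonical module $\omega_R$ is a cyclic $R$-module, i.e., there exists an element $\varphi\in\omega_R$ such that $\omega_R=\langle\varphi\rangle$. (c) There exists an element $\varphi\in\omega_R$ such that $\mathrm{Ann}_R(\varphi)=\{0\}$.
   Context: A 0-dimensional affine $K$-algebra is a ring $R=P/I$ with $P=K[x_1,\dots,x_n]$ and $I$ a proper ideal such that $\dim_K(P/I)<\infty$. Canonical module: $\omega_R=\mathrm{Hom}_K(R,K)$ with $R$-module structure $(f\cdot\varphi)(g)=\varphi(fg)$ for $f,g\in R$. Let $\langle0\rangle=\mathfrak q_1\cap\dots\cap\mathfrak q_s$ be the primary decomposition of the zero ideal of $R$; then $R\cong R/\mathfrak q_1\times\dots\times R/\mathfrak q_s$ with local factors. A 0-dimensional local ring $(A,\mathfrak m)$ is Gorenstein if $\dim_{A/\mathfrak m}\mathrm{Soc}(A)=1$, where $\mathrm{Soc}(A)=\mathrm{Ann}_A(\mathfrak m)$. $R$ is locally Gorenstein if every $R/\mathfrak q_i$ is a Gorenstein local ring. *)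

theory Defs
  imports
    "Jordan_Normal_Form.Missing_VectorSpace"
    "HOL-Algebra.Algebraic_Closure_Type"
    "HOL-Library.Poly_Mapping"
begin

text \<open>Names of the type-based libraries that shadow the record-based ones used here.\<close>

hide_const (open) Multiset.mult Modules.module Modules.module_hom Polynomial.smult

section \<open>Affine algebras\<close>

text \<open>A monomial is a finitely supported exponent vector, a polynomial a finitely supported
  family of coefficients; the variables are indexed from \<open>0\<close>.\<close>

type_synonym 'k mpoly = "(nat \<Rightarrow>\<^sub>0 nat) \<Rightarrow>\<^sub>0 'k"

definition mpoly_ring :: "nat \<Rightarrow> 'k::field mpoly ring" where
  "mpoly_ring n = ring_of_type_algebra
     \<lparr>carrier := {p. \<forall>m \<in> Poly_Mapping.keys p. Poly_Mapping.keys m \<subseteq> {..<n}}\<rparr>"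

abbreviation ground_field :: "'k::field ring" where
  "ground_field \<equiv> ring_of_type_algebra"

text \<open>The ring \<open>K[x\<^sub>1,\<dots>,x\<^sub>n]/I\<close> together with scalar multiplication by \<open>K\<close>, so that the result
  can be read both as a ring and as a \<open>K\<close>-module.\<close>

definition affine_algebra :: "nat \<Rightarrow> 'k::field mpoly set \<Rightarrow> ('k, 'k mpoly set) module" where
  "affine_algebra n I = ring.extend (mpoly_ring n Quot I)
     (module.fields (\<lambda>c C.
        (I +>\<^bsub>mpoly_ring n\<^esub> Poly_Mapping.single 0 c) \<otimes>\<^bsub>mpoly_ring n Quot I\<^esub> C))"

definition zero_dim_affine_algebra :: "('k::field, 'k mpoly set) module \<Rightarrow> bool" where
  "zero_dim_affine_algebra R \<longleftrightarrow>
     (\<exists>n I. ideal I (mpoly_ring n) \<and> I \<noteq> carrier (mpoly_ring n) \<and> R = affine_algebra n I \<and>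
       vectorspace.fin_dim ground_field R)"

section \<open>The canonical module\<close>

definition self_module :: "'a ring \<Rightarrow> ('a, 'a) module" where
  "self_module K = ring.extend K (module.fields (\<otimes>\<^bsub>K\<^esub>))"

text \<open>Functionals are taken extensional, so that equality of functionals is equality on the
  carrier of \<open>R\<close>.  The fields \<open>mult\<close> and \<open>one\<close>, which a module record must have, carry no meaning.\<close>

definition canonical_module :: "'k ring \<Rightarrow> ('k, 'a) module \<Rightarrow> ('a, 'a \<Rightarrow> 'k) module" where
  "canonical_module K R =
     \<lparr>carrier = module_hom K R (self_module K) \<inter> extensional (carrier R),
      mult = (\<lambda>\<phi> \<psi>. \<lambda>g \<in> carrier R. \<zero>\<^bsub>K\<^esub>),
      one = (\<lambda>g \<in> carrier R. \<zero>\<^bsub>K\<^esub>),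
      zero = (\<lambda>g \<in> carrier R. \<zero>\<^bsub>K\<^esub>),
      add = (\<lambda>\<phi> \<psi>. \<lambda>g \<in> carrier R. \<phi> g \<oplus>\<^bsub>K\<^esub> \<psi> g),
      smult = (\<lambda>f \<phi>. \<lambda>g \<in> carrier R. \<phi> (f \<otimes>\<^bsub>R\<^esub> g))\<rparr>"

definition annihilator :: "('a, 'r) ring_scheme \<Rightarrow> ('a, 'b, 'm) module_scheme \<Rightarrow> 'b \<Rightarrow> 'a set" where
  "annihilator R M x = {f \<in> carrier R. f \<odot>\<^bsub>M\<^esub> x = \<zero>\<^bsub>M\<^esub>}"

section \<open>Primary decompositions\<close>

definition ideal_radical :: "('a, 'r) ring_scheme \<Rightarrow> 'a set \<Rightarrow> 'a set" where
  "ideal_radical R J = {a \<in> carrier R. \<exists>k::nat. a [^]\<^bsub>R\<^esub> k \<in> J}"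

definition primary_ideal :: "('a, 'r) ring_scheme \<Rightarrow> 'a set \<Rightarrow> bool" where
  "primary_ideal R q \<longleftrightarrow> ideal q R \<and> q \<noteq> carrier R \<and>
     (\<forall>a \<in> carrier R. \<forall>b \<in> carrier R. a \<otimes>\<^bsub>R\<^esub> b \<in> q \<longrightarrow> a \<in> q \<or> b \<in> ideal_radical R q)"

text \<open>A minimal primary decomposition of \<open>J\<close>, as the set of its components: the components have
  pairwise distinct radicals and none of them can be left out.  For a zero-dimensional affine
  algebra it is unique, because all associated primes are maximal.  Intersecting with the carrier
  only matters for the empty family.\<close>

definition primary_decomposition :: "('a, 'r) ring_scheme \<Rightarrow> 'a set \<Rightarrow> 'a set set \<Rightarrow> bool" where
  "primary_decomposition R J Q \<longleftrightarrow> finite Q \<and> (\<forall>q \<in> Q. primary_ideal R q) \<and>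
     carrier R \<inter> \<Inter>Q = J \<and>
     (\<forall>q \<in> Q. carrier R \<inter> \<Inter>(Q - {q}) \<noteq> J) \<and>
     inj_on (ideal_radical R) Q"

section \<open>Gorenstein rings\<close>

definition local_ring :: "('a, 'r) ring_scheme \<Rightarrow> 'a set \<Rightarrow> bool" where
  "local_ring A m \<longleftrightarrow> cring A \<and> maximalideal m A \<and> (\<forall>m'. maximalideal m' A \<longrightarrow> m' = m)"

definition krull_dim_zero :: "('a, 'r) ring_scheme \<Rightarrow> bool" where
  "krull_dim_zero A \<longleftrightarrow> (\<exists>p. primeideal p A) \<and> (\<forall>p. primeideal p A \<longrightarrow> maximalideal p A)"

definition socle :: "('a, 'r) ring_scheme \<Rightarrow> 'a set \<Rightarrow> 'a set" where
  "socle A m = {a \<in> carrier A. \<forall>x \<in> m. x \<otimes>\<^bsub>A\<^esub> a = \<zero>\<^bsub>A\<^esub>}"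

text \<open>The socle as a vector space over \<open>A/m\<close>: a residue class \<open>C\<close> acts on \<open>s\<close> by \<open>a \<otimes> s\<close> for any
  representative \<open>a\<close> of \<open>C\<close>; the set of these products is a singleton since \<open>m\<close> annihilates \<open>s\<close>.\<close>

definition socle_space :: "'a ring \<Rightarrow> 'a set \<Rightarrow> ('a set, 'a) module" where
  "socle_space A m = ring.extend (A\<lparr>carrier := socle A m\<rparr>)
     (module.fields (\<lambda>C s. the_elem ((\<lambda>a. a \<otimes>\<^bsub>A\<^esub> s) ` C)))"

definition gorenstein_local_ring :: "'a ring \<Rightarrow> 'a set \<Rightarrow> bool" where
  "gorenstein_local_ring A m \<longleftrightarrow> local_ring A m \<and> krull_dim_zero A \<and>
     vectorspace.fin_dim (A Quot m) (socle_space A m) \<and>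
     vectorspace.dim (A Quot m) (socle_space A m) = 1"

definition locally_gorenstein :: "('a, 'r) ring_scheme \<Rightarrow> bool" where
  "locally_gorenstein R \<longleftrightarrow> (\<exists>Q. primary_decomposition R {\<zero>\<^bsub>R\<^esub>} Q \<and>
     (\<forall>q \<in> Q. \<exists>m. gorenstein_local_ring (R Quot q) m))"

end

theory Submission
  imports Defs
begin

text \<open>Write the elements of the canonical module as functionals \<open>\<phi>\<close>.  The annihilator of \<open>\<phi>\<close> is zero iff
  the bilinear form \<open>\<phi> (f g)\<close> is nondegenerate, and \<open>\<phi>\<close> generates iff every functional has the form
  \<open>g \<mapsto> \<phi> (f g)\<close>; in finite dimension the two are equivalent.  Nondegeneracy means that the kernel of \<open>\<phi>\<close>
  contains no nonzero ideal, and every nonzero ideal contains a nonzero element of the socle of one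
  of the local factors.  If these socles are one-dimensional, it suffices that \<open>\<phi>\<close> does not vanish on
  any of them.  Conversely, a nondegenerate \<open>\<phi>\<close> gives the double annihilator property of ideals, which
  forces two socle elements of the same factor to be proportional.\<close>

section \<open>Chain conditions and linear functionals\<close>

text \<open>The socles are one-dimensional over the residue fields, which may be larger than
  \<open>K\<close>, so a functional that is nonzero at one socle generator can still vanish at other
  socle elements. What matters is that a nonzero socle element of a factor is a unit multiple of the
  generator, so that an ideal containing the one contains the other. The local factors never appear
  as a product of rings: each component \<open>q\<close> comes with an element \<open>e\<close> that
  is congruent to one modulo \<open>q\<close>, lies in all other components and kills
  \<open>q\<close>. Multiplication by \<open>e\<close> turns congruences modulo \<open>q\<close>
  into equations in \<open>R\<close>. A dimension count in the dual space is avoided too: finitely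
  many translates of \<open>\<phi>\<close> already have zero common kernel, and a functional that
  vanishes on the common kernel of finitely many others is a combination of them. Since
  \<open>locally_gorenstein\<close> asks for some primary decomposition, one implication starts from
  a given decomposition, whereas the other has to construct one.\<close>

lemma (in vectorspace) subspace_rank:
  assumes "fin_dim"
  obtains \<mu> :: "'c set \<Rightarrow> nat" where
    "\<And>W. \<mu> W \<le> dim"
    "\<And>W W'. submodule K W V \<Longrightarrow> submodule K W' V \<Longrightarrow> W \<subset> W' \<Longrightarrow> \<mu> W < \<mu> W'"
proof
  \<comment> \<open>The rank is the largest size of an independent subset. It makes sense for an
    arbitrary set \<open>W\<close>, so no subspace has to be shown finite-dimensional first.\<close>
  define S where "S W = {card A | A. A \<subseteq> W \<inter> carrier V \<and> lin_indpt A}" for W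
  have bound: "S W \<subseteq> {..dim}" for W
    using li_le_dim(2)[OF assms] by (auto simp: S_def)
  then have fin: "finite (S W)" for W
    by (rule finite_subset) simp
  have "lin_indpt {}"
    by (auto simp: lin_dep_def)
  then have ne: "S W \<noteq> {}" for W
    unfolding S_def by blast
  show "Max (S W) \<le> dim" for W
    using Max_in[OF fin ne] bound by blast
  fix W W' assume W: "submodule K W V" and W': "submodule K W' V" and lt: "W \<subset> W'"
  obtain A where A: "A \<subseteq> W" "A \<subseteq> carrier V" "lin_indpt A" "card A = Max (S W)"
    using Max_in[OF fin ne, of W] by (auto simp: S_def)
  obtain v where v: "v \<in> W'" "v \<notin> W"
    using lt by blast
  have vc: "v \<in> carrier V"
    using submodule.subset[OF W'] v by blast
  have "span A \<subseteq> W"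
    by (rule span_is_subset[OF A(1) W])
  then have "lin_indpt (A \<union> {v})"
    using lin_dep_iff_in_span[OF A(2,3) vc] v A by blast
  then have "card (A \<union> {v}) \<in> S W'"
    using A v vc lt by (auto simp: S_def)
  moreover have "card (A \<union> {v}) = Suc (card A)"
    using li_le_dim(1)[OF assms A(2,3)] A v by (subst Un_commute) (auto simp: card_insert_if)
  ultimately show "Max (S W) < Max (S W')"
    using Max_ge[OF fin] A(4) by (metis Suc_le_lessD)
qed

text \<open>A member of least rank is minimal, because a proper subspace has smaller rank. This is
  the descending chain condition in the form that suits arguments by minimal choice.\<close>

lemma (in vectorspace) minimal_subspace:
  assumes "fin_dim" and "\<F> \<noteq> {}" and F: "\<And>W. W \<in> \<F> \<Longrightarrow> submodule K W V"
  shows "\<exists>W \<in> \<F>. \<forall>W' \<in> \<F>. W' \<subseteq> W \<longrightarrow> W' = W"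
proof -
  obtain \<mu> where \<mu>: "\<And>W W'. submodule K W V \<Longrightarrow> submodule K W' V \<Longrightarrow> W \<subset> W' \<Longrightarrow> \<mu> W < (\<mu> W' :: nat)"
    using subspace_rank[OF assms(1)] by metis
  obtain W where "W \<in> \<F>" "\<And>W'. W' \<in> \<F> \<Longrightarrow> \<mu> W \<le> \<mu> W'"
    using ex_has_least_nat[of "\<lambda>W. W \<in> \<F>" _ \<mu>] assms(2) by blast
  then show ?thesis
    using \<mu> F by (intro bexI[of _ W] ballI impI) (metis leD psubsetI)+
qed

lemma (in vectorspace) maximal_subspace:
  assumes "fin_dim" and "\<F> \<noteq> {}" and F: "\<And>W. W \<in> \<F> \<Longrightarrow> submodule K W V"
  shows "\<exists>W \<in> \<F>. \<forall>W' \<in> \<F>. W \<subseteq> W' \<longrightarrow> W' = W"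
proof -
  obtain \<mu> where \<mu>: "\<And>W. \<mu> W \<le> dim"
    "\<And>W W'. submodule K W V \<Longrightarrow> submodule K W' V \<Longrightarrow> W \<subset> W' \<Longrightarrow> \<mu> W < (\<mu> W' :: nat)"
    using subspace_rank[OF assms(1)] by metis
  obtain W where "W \<in> \<F>" "\<And>W'. W' \<in> \<F> \<Longrightarrow> \<mu> W' \<le> \<mu> W"
    using ex_has_greatest_nat[of "\<lambda>W. W \<in> \<F>" _ \<mu> "Suc dim"] assms(2) \<mu>(1) 
    by (metis all_not_in_conv le_imp_less_Suc)
  then show ?thesis
    using \<mu> F by (intro bexI[of _ W] ballI impI) (metis leD psubsetI)+
qed

section \<open>Linear functionals: separation and common kernels\<close>

lemma self_module_simps [simp]:
  "carrier (self_module K) = carrier K" "add (self_module K) = add K"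
  "zero (self_module K) = zero K" "smult (self_module K) = monoid.mult K"
  by (simp_all add: self_module_def ring.defs module.defs)

text \<open>A subspace \<open>U\<close> that is maximal among those containing \<open>W\<close> and
  missing \<open>v\<close> is a complement of the line through \<open>v\<close>. The functional
  reads off the coefficient of \<open>v\<close> modulo \<open>U\<close>, so no basis has to be
  extended.\<close>

lemma functional_separating:
  fixes K :: "'a ring" and V :: "('a, 'c, 'd) module_scheme"
  assumes vs: "vectorspace K V" and fd: "vectorspace.fin_dim K V" and W: "submodule K W V" and v: "v \<in> carrier V" "v \<notin> W"
  obtains f where "f \<in> module_hom K V (self_module K)" "\<And>w. w \<in> W \<Longrightarrow> f w = \<zero>\<^bsub>K\<^esub>" "f v \<noteq> \<zero>\<^bsub>K\<^esub>"
proof -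
  interpret vectorspace K V by fact
  let ?F = "{U. submodule K U V \<and> W \<subseteq> U \<and> v \<notin> U}"
  have F: "?F \<noteq> {}" "\<And>U. U \<in> ?F \<Longrightarrow> submodule K U V"
    using W v by auto
  obtain U where "U \<in> ?F" and max: "\<forall>W' \<in> ?F. U \<subseteq> W' \<longrightarrow> W' = U"
    using maximal_subspace[OF fd F] by (rule bexE)
  then have U0: "submodule K U V \<and> W \<subseteq> U \<and> v \<notin> U" by simp
  interpret U: submodule K U V using U0 by blast
  note Uc = subsetD[OF U.subset]
  have minus_zero [simp]: "\<ominus>\<^bsub>V\<^esub> \<zero>\<^bsub>V\<^esub> = \<zero>\<^bsub>V\<^esub>"
    using M.minus_equality[of "\<zero>\<^bsub>V\<^esub>" "\<zero>\<^bsub>V\<^esub>"] by simp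
  have neg: "\<ominus>\<^bsub>V\<^esub> u \<in> U" if "u \<in> U" for u
    using U.smult_closed[OF _ that, of "\<ominus>\<^bsub>K\<^esub> \<one>\<^bsub>K\<^esub>"] smult_minus_1[OF Uc[OF that]] by simp
  have diff: "u \<ominus>\<^bsub>V\<^esub> w \<in> U" if "u \<in> U" "w \<in> U" for u w
    using that neg by (simp add: a_minus_def)
  have ex: "\<exists>c \<in> carrier K. x \<ominus>\<^bsub>V\<^esub> c \<odot>\<^bsub>V\<^esub> v \<in> U" if x: "x \<in> carrier V" for x
  proof (cases "x \<in> U")
    case True
    then show ?thesis using x v by (intro bexI[of _ "\<zero>\<^bsub>K\<^esub>"]) (auto simp: a_minus_def)
  next
    case False
    let ?U = "{u \<oplus>\<^bsub>V\<^esub> c \<odot>\<^bsub>V\<^esub> x | u c. u \<in> U \<and> c \<in> carrier K}"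
    have "submodule K ?U V"
    proof (rule LinearCombinations.submodule.intro)
      show "module K V" by unfold_locales
      show "?U \<subseteq> carrier V" using Uc x by auto
      show "\<zero>\<^bsub>V\<^esub> \<in> ?U"
        using x by (intro CollectI exI[of _ "\<zero>\<^bsub>V\<^esub>"] exI[of _ "\<zero>\<^bsub>K\<^esub>"]) auto
      show "y \<oplus>\<^bsub>V\<^esub> z \<in> ?U" if yz: "y \<in> ?U" "z \<in> ?U" for y z
      proof -
        obtain u c u' c' where *: "y = u \<oplus>\<^bsub>V\<^esub> c \<odot>\<^bsub>V\<^esub> x" "u \<in> U" "c \<in> carrier K"
          "z = u' \<oplus>\<^bsub>V\<^esub> c' \<odot>\<^bsub>V\<^esub> x" "u' \<in> U" "c' \<in> carrier K" using yz by blast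
        then have "y \<oplus>\<^bsub>V\<^esub> z = (u \<oplus>\<^bsub>V\<^esub> u') \<oplus>\<^bsub>V\<^esub> (c \<oplus>\<^bsub>K\<^esub> c') \<odot>\<^bsub>V\<^esub> x"
          using x Uc by (simp add: smult_l_distr M.a_ac)
        then show ?thesis using * by blast
      qed
      show "d \<odot>\<^bsub>V\<^esub> y \<in> ?U" if d: "d \<in> carrier K" and y: "y \<in> ?U" for d y
      proof -
        obtain u c where *: "y = u \<oplus>\<^bsub>V\<^esub> c \<odot>\<^bsub>V\<^esub> x" "u \<in> U" "c \<in> carrier K"
          using y by blast
        then have "d \<odot>\<^bsub>V\<^esub> y = d \<odot>\<^bsub>V\<^esub> u \<oplus>\<^bsub>V\<^esub> (d \<otimes>\<^bsub>K\<^esub> c) \<odot>\<^bsub>V\<^esub> x"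
          using x Uc d by (simp add: smult_r_distr smult_assoc1)
        then show ?thesis using * d by blast
      qed
    qed
    moreover have sub: "U \<subseteq> ?U"
    proof
      fix u assume "u \<in> U"
      then show "u \<in> ?U" using x Uc by (intro CollectI exI[of _ u] exI[of _ "\<zero>\<^bsub>K\<^esub>"]) auto
    qed
    moreover have "x \<in> ?U"
      using x by (intro CollectI exI[of _ "\<zero>\<^bsub>V\<^esub>"] exI[of _ "\<one>\<^bsub>K\<^esub>"]) auto
    ultimately have "v \<in> ?U"
      using bspec[OF max, of ?U] False U0 by blast
    then obtain u c where *: "v = u \<oplus>\<^bsub>V\<^esub> c \<odot>\<^bsub>V\<^esub> x" "u \<in> U" "c \<in> carrier K" by blast
    \<comment> \<open>Since \<open>v\<close> is not in \<open>U\<close>, the coefficient of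
      \<open>x\<close> is nonzero, and the equation can be solved for \<open>x\<close> modulo
      \<open>U\<close>.\<close>
    have c: "c \<noteq> \<zero>\<^bsub>K\<^esub>" using * U0 x Uc by auto
    let ?d = "inv\<^bsub>K\<^esub> c"
    have d: "?d \<in> carrier K" "?d \<otimes>\<^bsub>K\<^esub> c = \<one>\<^bsub>K\<^esub>"
      using c * field_Units by auto
    have "?d \<odot>\<^bsub>V\<^esub> v = ?d \<odot>\<^bsub>V\<^esub> u \<oplus>\<^bsub>V\<^esub> x"
      using * d x Uc by (simp add: smult_r_distr smult_assoc1[symmetric])
    then have "x \<ominus>\<^bsub>V\<^esub> ?d \<odot>\<^bsub>V\<^esub> v = \<ominus>\<^bsub>V\<^esub> (?d \<odot>\<^bsub>V\<^esub> u)"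
      using d x *(2) Uc[OF *(2)] by (simp add: a_minus_def M.minus_add M.a_ac M.r_neg1 M.r_neg2)
    then have "x \<ominus>\<^bsub>V\<^esub> ?d \<odot>\<^bsub>V\<^esub> v \<in> U"
      using neg[OF U.smult_closed[OF d(1) *(2)]] by (simp only:)
    then show ?thesis using d(1) by blast
  qed
  have uniq: "c = d" if "x \<in> carrier V" "c \<in> carrier K" "d \<in> carrier K"
    "x \<ominus>\<^bsub>V\<^esub> c \<odot>\<^bsub>V\<^esub> v \<in> U" "x \<ominus>\<^bsub>V\<^esub> d \<odot>\<^bsub>V\<^esub> v \<in> U" for x c d
  proof (rule ccontr)
    assume "c \<noteq> d"
    define e where "e = d \<ominus>\<^bsub>K\<^esub> c"
    have e: "e \<in> carrier K" "e \<noteq> \<zero>\<^bsub>K\<^esub>"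
      using \<open>c \<noteq> d\<close> that by (auto simp: e_def)
    have "(x \<ominus>\<^bsub>V\<^esub> c \<odot>\<^bsub>V\<^esub> v) \<ominus>\<^bsub>V\<^esub> (x \<ominus>\<^bsub>V\<^esub> d \<odot>\<^bsub>V\<^esub> v) = e \<odot>\<^bsub>V\<^esub> v"
      using that v by (simp add: e_def a_minus_def M.minus_add M.a_ac M.r_neg1 M.r_neg2 smult_l_distr smult_l_minus)
    then have "e \<odot>\<^bsub>V\<^esub> v \<in> U" using diff that by metis
    then have "inv\<^bsub>K\<^esub> e \<odot>\<^bsub>V\<^esub> (e \<odot>\<^bsub>V\<^esub> v) \<in> U" using e field_Units by auto
    then have "v \<in> U" using e v field_Units by (simp add: smult_assoc1[symmetric])
    then show False using U0 by blast
  qed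
  define f where "f x = (THE c. c \<in> carrier K \<and> x \<ominus>\<^bsub>V\<^esub> c \<odot>\<^bsub>V\<^esub> v \<in> U)" for x
  have fI: "f x = c" if "x \<in> carrier V" "c \<in> carrier K" "x \<ominus>\<^bsub>V\<^esub> c \<odot>\<^bsub>V\<^esub> v \<in> U" for x c
    unfolding f_def using that uniq by blast
  have f: "f x \<in> carrier K" "x \<ominus>\<^bsub>V\<^esub> f x \<odot>\<^bsub>V\<^esub> v \<in> U" if "x \<in> carrier V" for x
    using ex[OF that] fI[OF that] by auto
  have "f \<in> module_hom K V (self_module K)"
    unfolding LinearCombinations.module_hom_def
  proof (simp, intro conjI allI impI)
    show "f \<in> carrier V \<rightarrow> carrier K" using f by blast
    fix x y assume xy: "x \<in> carrier V \<and> y \<in> carrier V"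
    have "(x \<oplus>\<^bsub>V\<^esub> y) \<ominus>\<^bsub>V\<^esub> (f x \<oplus>\<^bsub>K\<^esub> f y) \<odot>\<^bsub>V\<^esub> v
      = (x \<ominus>\<^bsub>V\<^esub> f x \<odot>\<^bsub>V\<^esub> v) \<oplus>\<^bsub>V\<^esub> (y \<ominus>\<^bsub>V\<^esub> f y \<odot>\<^bsub>V\<^esub> v)"
      using xy f v by (simp add: a_minus_def smult_l_distr M.minus_add M.a_ac)
    then show "f (x \<oplus>\<^bsub>V\<^esub> y) = f x \<oplus>\<^bsub>K\<^esub> f y"
      using f xy by (intro fI) auto
  next
    fix r x assume rx: "r \<in> carrier K \<and> x \<in> carrier V"
    have "(r \<odot>\<^bsub>V\<^esub> x) \<ominus>\<^bsub>V\<^esub> (r \<otimes>\<^bsub>K\<^esub> f x) \<odot>\<^bsub>V\<^esub> v = r \<odot>\<^bsub>V\<^esub> (x \<ominus>\<^bsub>V\<^esub> f x \<odot>\<^bsub>V\<^esub> v)"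
      using rx f v by (simp add: a_minus_def smult_r_distr smult_r_minus smult_assoc1)
    then show "f (r \<odot>\<^bsub>V\<^esub> x) = r \<otimes>\<^bsub>K\<^esub> f x"
      using f rx by (intro fI) auto
  qed
  moreover have "f w = \<zero>\<^bsub>K\<^esub>" if "w \<in> W" for w
    using that U0 Uc v by (intro fI) (auto simp: a_minus_def)
  moreover have "f v = \<one>\<^bsub>K\<^esub>"
    using v by (intro fI) (auto simp: a_minus_def M.r_neg)
  ultimately show thesis using that by simp
qed

text \<open>Closure of \<open>E\<close> under linear combinations replaces an explicit span of \<open>F\<close>.\<close>

lemma functional_in_of_common_kernel:
  fixes K :: "'a ring" and V :: "('a, 'c, 'd) module_scheme"
  assumes vs: "vectorspace K V" and E: "E \<subseteq> module_hom K V (self_module K)"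
    and zero: "(\<lambda>x. \<zero>\<^bsub>K\<^esub>) \<in> E"
    and comb: "\<And>p f c. p \<in> E \<Longrightarrow> f \<in> E \<Longrightarrow> c \<in> carrier K \<Longrightarrow> (\<lambda>x. p x \<oplus>\<^bsub>K\<^esub> c \<otimes>\<^bsub>K\<^esub> f x) \<in> E"
    and "finite F" "F \<subseteq> E" "g \<in> module_hom K V (self_module K)"
    and "\<And>x. x \<in> carrier V \<Longrightarrow> (\<And>f. f \<in> F \<Longrightarrow> f x = \<zero>\<^bsub>K\<^esub>) \<Longrightarrow> g x = \<zero>\<^bsub>K\<^esub>"
  shows "\<exists>h \<in> E. \<forall>x \<in> carrier V. g x = h x"
  using assms(5-)
proof (induction F arbitrary: g rule: finite_induct)
  case empty
  then show ?case using zero by (intro bexI[of _ "\<lambda>x. \<zero>\<^bsub>K\<^esub>"]) auto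
next
  case (insert f F)
  interpret vectorspace K V by (rule vs)
  have hom: "p x \<in> carrier K" "\<And>y. y \<in> carrier V \<Longrightarrow> p (x \<oplus>\<^bsub>V\<^esub> y) = p x \<oplus>\<^bsub>K\<^esub> p y"
    "\<And>c. c \<in> carrier K \<Longrightarrow> p (c \<odot>\<^bsub>V\<^esub> x) = c \<otimes>\<^bsub>K\<^esub> p x"
    if "p \<in> module_hom K V (self_module K)" "x \<in> carrier V" for p x
    using that by (auto simp: LinearCombinations.module_hom_def)
  have fh: "f \<in> module_hom K V (self_module K)" and FE: "F \<subseteq> E" and fE: "f \<in> E"
    using insert.prems E by auto
  show ?case
  proof (cases "\<forall>x \<in> carrier V. (\<forall>p \<in> F. p x = \<zero>\<^bsub>K\<^esub>) \<longrightarrow> f x = \<zero>\<^bsub>K\<^esub>")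
    case True
    then show ?thesis using insert.prems FE by (intro insert.IH) auto
  next
    case False
    then obtain n where n: "n \<in> carrier V" "\<And>p. p \<in> F \<Longrightarrow> p n = \<zero>\<^bsub>K\<^esub>" "f n \<noteq> \<zero>\<^bsub>K\<^esub>" by blast
    define i where "i = inv\<^bsub>K\<^esub> (f n)"
    have i: "i \<in> carrier K" "i \<otimes>\<^bsub>K\<^esub> f n = \<one>\<^bsub>K\<^esub>"
      using n hom(1)[OF fh n(1)] field_Units by (auto simp: i_def)
    define c where "c = g n \<otimes>\<^bsub>K\<^esub> i"
    have gh: "g \<in> module_hom K V (self_module K)" by fact
    have c: "c \<in> carrier K" using i n hom(1)[OF gh n(1)] by (auto simp: c_def)
    \<comment> \<open>The multiple of \<open>f\<close> is chosen so that \<open>?g\<close> vanishes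
      at \<open>n\<close>; shifting an argument along \<open>n\<close> therefore does not change
      \<open>?g\<close>.\<close>
    let ?g = "\<lambda>x. g x \<oplus>\<^bsub>K\<^esub> (\<ominus>\<^bsub>K\<^esub> c) \<otimes>\<^bsub>K\<^esub> f x"
    have "\<exists>h \<in> E. \<forall>x \<in> carrier V. ?g x = h x"
    proof (rule insert.IH[OF FE])
      show "?g \<in> module_hom K V (self_module K)"
        using c hom[OF gh] hom[OF fh] unfolding LinearCombinations.module_hom_def
        by (auto simp: R.r_distr R.a_ac R.m_ac R.l_minus R.minus_add R.r_minus)
      fix x assume x: "x \<in> carrier V" "\<And>p. p \<in> F \<Longrightarrow> p x = \<zero>\<^bsub>K\<^esub>"
      \<comment> \<open>The shift by \<open>d\<close> times \<open>n\<close> brings \<open>x\<close>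
        into the kernel of \<open>f\<close> without leaving the kernels of the members of
        \<open>F\<close>, so the hypothesis on \<open>g\<close> applies to the shifted
        vector.\<close>
      define d where "d = \<ominus>\<^bsub>K\<^esub> (f x \<otimes>\<^bsub>K\<^esub> i)"
      have fx: "f x \<in> carrier K" "f n \<in> carrier K" "g x \<in> carrier K" "g n \<in> carrier K"
        using hom(1)[OF fh] hom(1)[OF gh] x n i by auto
      have d: "d \<in> carrier K" using fx i by (simp add: d_def)
      have "g (x \<oplus>\<^bsub>V\<^esub> d \<odot>\<^bsub>V\<^esub> n) = \<zero>\<^bsub>K\<^esub>"
      proof (rule insert.prems(3))
        show "x \<oplus>\<^bsub>V\<^esub> d \<odot>\<^bsub>V\<^esub> n \<in> carrier V" using x n d by simp
        fix p assume "p \<in> insert f F"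
        then consider "p = f" | "p \<in> F" by blast
        then show "p (x \<oplus>\<^bsub>V\<^esub> d \<odot>\<^bsub>V\<^esub> n) = \<zero>\<^bsub>K\<^esub>"
        proof cases
          case 1
          have "f (x \<oplus>\<^bsub>V\<^esub> d \<odot>\<^bsub>V\<^esub> n) = f x \<oplus>\<^bsub>K\<^esub> d \<otimes>\<^bsub>K\<^esub> f n"
            using hom[OF fh] x n d by simp
          also have "\<dots> = f x \<ominus>\<^bsub>K\<^esub> f x \<otimes>\<^bsub>K\<^esub> (i \<otimes>\<^bsub>K\<^esub> f n)"
            using fx i by (simp add: d_def a_minus_def R.l_minus R.m_assoc)
          finally show ?thesis using fx i 1 by (simp add: a_minus_def R.r_neg)
        next
          case 2
          then have "p \<in> module_hom K V (self_module K)" using FE E by blast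
          note hom = hom[OF this]
          have "p x = \<zero>\<^bsub>K\<^esub>" "p n = \<zero>\<^bsub>K\<^esub>" using x(2) n(2) 2 by auto
          then show ?thesis using hom(2)[OF x(1), of "d \<odot>\<^bsub>V\<^esub> n"] hom(3)[OF n(1) d] n(1) d by simp
        qed
      qed
      then have "g x \<oplus>\<^bsub>K\<^esub> d \<otimes>\<^bsub>K\<^esub> g n = \<zero>\<^bsub>K\<^esub>" using hom[OF gh] x n d by simp
      then show "?g x = \<zero>\<^bsub>K\<^esub>"
        using fx i by (simp add: c_def d_def R.l_minus R.r_minus R.m_ac)
    qed
    then obtain h where h: "h \<in> E" "\<And>x. x \<in> carrier V \<Longrightarrow> ?g x = h x" by blast
    have "g x = h x \<oplus>\<^bsub>K\<^esub> c \<otimes>\<^bsub>K\<^esub> f x" if "x \<in> carrier V" for x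
      using h(2)[OF that, symmetric] hom(1)[OF gh that] hom(1)[OF fh that] c
      by (simp add: R.l_minus R.a_ac R.r_neg R.r_neg1 R.r_neg2)
    then show ?thesis by (intro bexI[OF _ comb[OF h(1) fE c]]) simp
  qed
qed

section \<open>Primary decomposition\<close>

text \<open>Both chain conditions for ideals, in terms of families. They are all that the ideal
  theory needs from finite dimension, and assuming both spares the passage from Artinian to
  Noetherian.\<close>

locale chain_cring = cring R for R (structure) +
  assumes minimal_ideal: "\<F> \<noteq> {} \<Longrightarrow> (\<And>I. I \<in> \<F> \<Longrightarrow> ideal I R) \<Longrightarrow>
      \<exists>I \<in> \<F>. \<forall>J \<in> \<F>. J \<subseteq> I \<longrightarrow> J = I"
    and maximal_ideal: "\<F> \<noteq> {} \<Longrightarrow> (\<And>I. I \<in> \<F> \<Longrightarrow> ideal I R) \<Longrightarrow>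
      \<exists>I \<in> \<F>. \<forall>J \<in> \<F>. I \<subseteq> J \<longrightarrow> J = I"

section \<open>Ideals, primes and maximal ideals\<close>

lemma (in cring) ideal_of_closed:
  assumes "I \<subseteq> carrier R" "\<zero> \<in> I" "\<And>a b. a \<in> I \<Longrightarrow> b \<in> I \<Longrightarrow> a \<oplus> b \<in> I"
    "\<And>a r. a \<in> I \<Longrightarrow> r \<in> carrier R \<Longrightarrow> r \<otimes> a \<in> I"
  shows "ideal I R"
proof (rule idealI)
  show "ring R" by unfold_locales
  show "subgroup I (add_monoid R)"
  proof (rule add.subgroupI)
    fix a assume "a \<in> I"
    then show "\<ominus> a \<in> I"
      using assms(4)[of a "\<ominus> \<one>"] assms(1) by (auto simp: l_minus)
  qed (use assms in auto)
  show "x \<otimes> a \<in> I" "a \<otimes> x \<in> I" if "a \<in> I" "x \<in> carrier R" for a x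
    using that assms(1,4) by (auto simp: m_comm[of a x])
qed

lemma (in ring) set_add_memI: "a \<in> I \<Longrightarrow> b \<in> J \<Longrightarrow> a \<oplus> b \<in> I <+>\<^bsub>R\<^esub> J"
  by (auto simp: set_add_def')

lemma (in cring) ideal_closed:
  assumes "ideal I R"
  shows "I \<subseteq> carrier R" "\<zero> \<in> I"
    "\<And>a b. a \<in> I \<Longrightarrow> b \<in> I \<Longrightarrow> a \<oplus> b \<in> I" "\<And>a b. a \<in> I \<Longrightarrow> b \<in> I \<Longrightarrow> a \<ominus> b \<in> I"
    "\<And>a r. a \<in> I \<Longrightarrow> r \<in> carrier R \<Longrightarrow> r \<otimes> a \<in> I"
    "\<And>a r. a \<in> I \<Longrightarrow> r \<in> carrier R \<Longrightarrow> a \<otimes> r \<in> I"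
    "\<one> \<in> I \<Longrightarrow> I = carrier R"
proof -
  interpret ideal I R by fact
  show "I \<subseteq> carrier R" by (rule a_subset)
  show "\<zero> \<in> I" by simp
  show "\<And>a b. a \<in> I \<Longrightarrow> b \<in> I \<Longrightarrow> a \<oplus> b \<in> I" "\<And>a b. a \<in> I \<Longrightarrow> b \<in> I \<Longrightarrow> a \<ominus> b \<in> I"
    by (auto simp: a_minus_def)
  show "\<And>a r. a \<in> I \<Longrightarrow> r \<in> carrier R \<Longrightarrow> r \<otimes> a \<in> I"
    "\<And>a r. a \<in> I \<Longrightarrow> r \<in> carrier R \<Longrightarrow> a \<otimes> r \<in> I"
    by (auto simp: I_l_closed I_r_closed)
  show "\<one> \<in> I \<Longrightarrow> I = carrier R" by (rule one_imp_carrier)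
qed

lemma (in cring) ideal_Int_Inter:
  assumes "\<And>q. q \<in> F \<Longrightarrow> ideal q R"
  shows "ideal (carrier R \<inter> \<Inter>F) R"
  by (rule ideal_of_closed) (use ideal_closed[OF assms] in auto)

lemma (in cring) primeideal_mem:
  assumes "primeideal p R" 
  shows "\<one> \<notin> p" "a \<in> carrier R \<Longrightarrow> b \<in> carrier R \<Longrightarrow> a \<otimes> b \<in> p \<Longrightarrow> a \<in> p \<or> b \<in> p"
    "a \<in> carrier R \<Longrightarrow> a [^] (k::nat) \<in> p \<Longrightarrow> a \<in> p"
proof -
  interpret primeideal p R by fact
  show 1: "\<one> \<notin> p" using I_notcarr one_imp_carrier by metis
  show "a \<in> carrier R \<Longrightarrow> b \<in> carrier R \<Longrightarrow> a \<otimes> b \<in> p \<Longrightarrow> a \<in> p \<or> b \<in> p"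
    by (rule I_prime)
  show "a \<in> carrier R \<Longrightarrow> a [^] k \<in> p \<Longrightarrow> a \<in> p"
  proof (induction k)
    case 0
    then show ?case using 1 by simp
  next
    case (Suc k)
    then show ?case using I_prime[of "a [^] k" a] by auto
  qed
qed

text \<open>If every member had an element outside \<open>p\<close>, the product of these elements
  would lie in the intersection but not in the prime \<open>p\<close>. For the empty family the
  product is one.\<close>

lemma (in cring) prime_contains_Inter:
  assumes p: "primeideal p R" and "finite F" "\<And>q. q \<in> F \<Longrightarrow> ideal q R"
    and "carrier R \<inter> \<Inter>F \<subseteq> p"
  shows "\<exists>q \<in> F. q \<subseteq> p"
proof (rule ccontr)
  assume neg: "\<not> (\<exists>q \<in> F. q \<subseteq> p)"
  have "\<exists>a \<in> carrier R \<inter> \<Inter>F. a \<notin> p"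
    using assms(2,3) neg
  proof (induction F rule: finite_induct)
    case empty
    then show ?case using primeideal_mem(1)[OF p] by auto
  next
    case (insert q F)
    then obtain a where a: "a \<in> carrier R" "a \<in> \<Inter>F" "a \<notin> p" by auto
    obtain b where b: "b \<in> q" "b \<notin> p" using insert.prems by blast
    have q: "ideal q R" using insert.prems by blast
    then have bc: "b \<in> carrier R" using b ideal_closed(1) by blast
    have "a \<otimes> b \<notin> p" using primeideal_mem(2)[OF p] a bc b by blast
    moreover have "a \<otimes> b \<in> q" using ideal_closed(5)[OF q] a b by blast
    moreover have "a \<otimes> b \<in> \<Inter>F"
      using ideal_closed(6)[OF insert.prems(1)] a bc by blast
    ultimately show ?case using a bc by blast
  qed
  then show False using assms(4) by blast
qed

lemma (in cring) maximal_idealD: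
  assumes "maximalideal m R"
  shows "primeideal m R" "ideal m R" "\<one> \<notin> m"
    and "ideal J R \<Longrightarrow> m \<subseteq> J \<Longrightarrow> \<one> \<notin> J \<Longrightarrow> J = m"
proof -
  interpret m: maximalideal m R by fact
  show p: "primeideal m R" by (rule maximalideal_prime[OF assms])
  show "ideal m R" by (rule m.is_ideal)
  show "\<one> \<notin> m" by (rule primeideal_mem[OF p])
  show "ideal J R \<Longrightarrow> m \<subseteq> J \<Longrightarrow> \<one> \<notin> J \<Longrightarrow> J = m"
    using m.I_maximal[of J] ideal_closed(1)[of J] by auto
qed

lemma (in chain_cring) ideal_le_maximal:
  assumes "ideal I R" "\<one> \<notin> I"
  obtains m where "maximalideal m R" "I \<subseteq> m"
proof -
  let ?F = "{J. ideal J R \<and> I \<subseteq> J \<and> \<one> \<notin> J}"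
  have F: "?F \<noteq> {}" "\<And>J. J \<in> ?F \<Longrightarrow> ideal J R" using assms by auto
  obtain m where m: "m \<in> ?F" "\<forall>J \<in> ?F. m \<subseteq> J \<longrightarrow> J = m"
    using maximal_ideal[OF F] by (rule bexE)
  have "maximalideal m R"
  proof (rule maximalidealI)
    show "carrier R \<noteq> m" using m(1) by auto
    show "J = m \<or> J = carrier R" if "ideal J R" "m \<subseteq> J" for J
      using m(1) bspec[OF m(2), of J] that ideal_closed(7)[OF that(1)] by blast
  qed (use m in auto)
  then show thesis using that m by blast
qed

text \<open>The descending chain of the ideals generated by the powers of \<open>a\<close> stops,
  which gives \<open>a^k = b a^(k+1)\<close>. The vanishing product is then tested against prime and
  primary ideals: whichever factor is known to stay outside, the other one must give way.\<close>

lemma (in chain_cring) power_stable: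
  assumes a: "a \<in> carrier R"
  obtains k :: nat and b where "b \<in> carrier R" "a [^] k \<otimes> (\<one> \<ominus> a \<otimes> b) = \<zero>"
proof -
  let ?F = "range (\<lambda>k::nat. PIdl (a [^] k))"
  have F: "?F \<noteq> {}" "\<And>J. J \<in> ?F \<Longrightarrow> ideal J R" using a cgenideal_ideal by auto
  obtain I where I: "I \<in> ?F" "\<forall>J \<in> ?F. J \<subseteq> I \<longrightarrow> J = I"
    using minimal_ideal[OF F] by (rule bexE)
  then obtain k :: nat where k: "I = PIdl (a [^] k)" by auto
  have "PIdl (a [^] Suc k) \<subseteq> PIdl (a [^] k)"
    using a cgenideal_ideal[of "a [^] k"] 
    by (intro cgenideal_minimal) (auto simp: cgenideal_def m_comm[of "a [^] k"])
  then have "a [^] k \<in> PIdl (a [^] Suc k)"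
    using bspec[OF I(2), of "PIdl (a [^] Suc k)"] a cgenideal_self[of "a [^] k"] unfolding k by blast
  then obtain b where b: "b \<in> carrier R" "a [^] k = b \<otimes> (a [^] k \<otimes> a)"
    by (auto simp: cgenideal_def)
  have "a [^] k \<otimes> (\<one> \<ominus> a \<otimes> b) = a [^] k \<ominus> b \<otimes> (a [^] k \<otimes> a)"
    using a b(1) by (simp add: a_minus_def r_distr r_minus m_ac)
  also have "\<dots> = \<zero>" using a b(1) by (subst b(2)[symmetric]) (simp add: a_minus_def r_neg)
  finally show thesis using that b by blast
qed

section \<open>Primary ideals in dimension zero\<close>

lemma (in cring) primary_idealD:
  assumes "primary_ideal R q"
  shows "ideal q R" "\<one> \<notin> q"
    "a \<in> carrier R \<Longrightarrow> b \<in> carrier R \<Longrightarrow> a \<otimes> b \<in> q \<Longrightarrow> a \<in> q \<or> b \<in> ideal_radical R q"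
  using assms ideal_closed(7) unfolding primary_ideal_def by auto

text \<open>For \<open>a\<close> in \<open>m\<close> the factor \<open>1 - a b\<close> of the
  vanishing product in \<open>power_stable\<close> is outside \<open>m\<close>, hence outside the
  radical of \<open>q\<close>, so a power of \<open>a\<close> must lie in \<open>q\<close>. In
  particular only one maximal ideal contains \<open>q\<close>.\<close>

lemma (in chain_cring) primary_radical_eq:
  assumes q: "primary_ideal R q" and m: "maximalideal m R" and "q \<subseteq> m"
  shows "ideal_radical R q = m"
proof
  have p: "primeideal m R" using maximal_idealD[OF m] by blast
  show sub: "ideal_radical R q \<subseteq> m"
    using primeideal_mem(3)[OF p] assms(3) by (auto simp: ideal_radical_def)
  show "m \<subseteq> ideal_radical R q"
  proof
    fix a assume am: "a \<in> m"
    have mi: "ideal m R" using maximal_idealD[OF m] by blast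
    then have a: "a \<in> carrier R" using am ideal_closed(1) by blast
    obtain k :: nat and b where kb: "b \<in> carrier R" "a [^] k \<otimes> (\<one> \<ominus> a \<otimes> b) = \<zero>"
      using power_stable[OF a] .
    have "\<one> \<ominus> a \<otimes> b \<notin> m"
    proof
      assume "\<one> \<ominus> a \<otimes> b \<in> m"
      then have "(\<one> \<ominus> a \<otimes> b) \<oplus> a \<otimes> b \<in> m"
        using ideal_closed(3,6)[OF mi] am kb by blast
      then show False using maximal_idealD(3)[OF m] a kb
        by (simp add: a_minus_def a_assoc l_neg)
    qed
    then have "a [^] k \<in> q"
      using primary_idealD(3)[OF q, of "a [^] k" "\<one> \<ominus> a \<otimes> b"] kb a sub
        ideal_closed(2)[OF primary_idealD(1)[OF q]] by auto
    then show "a \<in> ideal_radical R q" using a by (auto simp: ideal_radical_def)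
  qed
qed

lemma (in cring) subset_radical: "ideal q R \<Longrightarrow> q \<subseteq> ideal_radical R q"
  using ideal_closed(1)[of q] by (auto simp: ideal_radical_def intro!: exI[of _ "1::nat"])

lemma (in chain_cring) primary_radical_maximal:
  assumes q: "primary_ideal R q"
  shows "maximalideal (ideal_radical R q) R"
  using ideal_le_maximal[OF primary_idealD(1,2)[OF q]] primary_radical_eq[OF q] by metis

text \<open>The component \<open>q\<close> and the intersection of the others are comaximal: a
  maximal ideal above both would contain another component by primality, and the two components
  would share their radical. The element \<open>e\<close> comes from writing one as a sum across
  these two ideals. It represents the unit of the local factor belonging to \<open>q\<close>; its
  products with \<open>q\<close> lie in every component and hence vanish.\<close>

lemma (in chain_cring) decomposition_idempotent:
  assumes Q: "primary_decomposition R {\<zero>} Q" and q: "q \<in> Q"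
  obtains e where "e \<in> carrier R" "\<one> \<ominus> e \<in> q" "\<And>q'. q' \<in> Q \<Longrightarrow> q' \<noteq> q \<Longrightarrow> e \<in> q'"
    "\<And>x. x \<in> q \<Longrightarrow> e \<otimes> x = \<zero>"
proof -
  have fin: "finite Q" and prim: "\<And>q. q \<in> Q \<Longrightarrow> primary_ideal R q"
    and int: "carrier R \<inter> \<Inter>Q = {\<zero>}" and inj: "inj_on (ideal_radical R) Q"
    using Q by (auto simp: primary_decomposition_def)
  note id = primary_idealD(1)[OF prim]
  let ?J = "carrier R \<inter> \<Inter>(Q - {q})"
  have J: "ideal ?J R" by (rule ideal_Int_Inter) (use id in auto)
  have sum: "ideal (q <+>\<^bsub>R\<^esub> ?J) R" by (rule add_ideals[OF id[OF q] J])
  have "\<one> \<in> q <+>\<^bsub>R\<^esub> ?J"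
  proof (rule ccontr)
    assume "\<one> \<notin> q <+>\<^bsub>R\<^esub> ?J"
    then obtain m where m: "maximalideal m R" "q <+>\<^bsub>R\<^esub> ?J \<subseteq> m"
      using ideal_le_maximal[OF sum] by blast
    have "x \<in> q <+>\<^bsub>R\<^esub> ?J" if "x \<in> q" for x
      using set_add_memI[OF that ideal_closed(2)[OF J]] that ideal_closed(1)[OF id[OF q]] by auto
    moreover have "x \<in> q <+>\<^bsub>R\<^esub> ?J" if "x \<in> ?J" for x
      using set_add_memI[OF ideal_closed(2)[OF id[OF q]] that] that by auto
    ultimately have qm: "q \<subseteq> m" and Jm: "?J \<subseteq> m" using m(2) by auto
    have "\<exists>q' \<in> Q - {q}. q' \<subseteq> m"
      by (rule prime_contains_Inter[OF maximal_idealD(1)[OF m(1)]]) (use fin id Jm in auto)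
    then obtain q' where q': "q' \<in> Q" "q' \<noteq> q" "q' \<subseteq> m" by blast
    then have "ideal_radical R q' = ideal_radical R q"
      using primary_radical_eq[OF prim m(1)] q qm by metis
    then show False using inj q q' by (auto dest: inj_onD)
  qed
  then obtain x e where xe: "x \<in> q" "e \<in> ?J" "\<one> = x \<oplus> e" unfolding set_add_def' by auto
  have x: "x \<in> carrier R" using xe ideal_closed(1)[OF id[OF q]] by blast
  show thesis
  proof
    show e: "e \<in> carrier R" and eq: "\<And>q'. q' \<in> Q \<Longrightarrow> q' \<noteq> q \<Longrightarrow> e \<in> q'" using xe by auto
    have "\<one> \<ominus> e = x" using xe(3) x e by (simp add: a_minus_def a_assoc r_neg)
    then show "\<one> \<ominus> e \<in> q" using xe by simp
    fix y assume y: "y \<in> q"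
    then have yc: "y \<in> carrier R" using ideal_closed(1)[OF id[OF q]] by blast
    have "e \<otimes> y \<in> q'" if "q' \<in> Q" for q'
      using ideal_closed(5,6)[OF id[OF that]] eq[OF that] y yc e by (cases "q' = q") auto
    then have "e \<otimes> y \<in> carrier R \<inter> \<Inter>Q" using e yc by auto
    then show "e \<otimes> y = \<zero>" using int by blast
  qed
qed

text \<open>These kernels are the primary components of zero.\<close>

definition localization_kernel :: "('a, 'r) ring_scheme \<Rightarrow> 'a set \<Rightarrow> 'a set" where
  "localization_kernel R m = {a \<in> carrier R. \<exists>s \<in> carrier R - m. s \<otimes>\<^bsub>R\<^esub> a = \<zero>\<^bsub>R\<^esub>}"

text \<open>The set is the kernel of the localization map at \<open>m\<close>. Each \<open>a\<close>
  in \<open>m\<close> has a power killed by some \<open>1 - a b\<close> outside \<open>m\<close>, so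
  the radical contains \<open>m\<close>. If \<open>s\<close> outside \<open>m\<close> kills
  \<open>a b\<close>, then either \<open>b\<close> is in \<open>m\<close> and so in the radical, or
  \<open>s b\<close> is outside \<open>m\<close> and kills \<open>a\<close>.\<close>

lemma (in chain_cring) localization_kernel:
  assumes m: "maximalideal m R"
  shows "primary_ideal R (localization_kernel R m)" "localization_kernel R m \<subseteq> m"
    "ideal_radical R (localization_kernel R m) = m"
proof -
  let ?N = "localization_kernel R m"
  note mp = maximal_idealD(1)[OF m] and mi = maximal_idealD(2)[OF m] and m1 = maximal_idealD(3)[OF m]
  have mult: "s \<otimes> t \<in> carrier R - m" if "s \<in> carrier R - m" "t \<in> carrier R - m" for s t
    using that primeideal_mem(2)[OF mp] by blast
  have one: "\<one> \<in> carrier R - m" using m1 by simp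
  have N: "ideal ?N R"
  proof (rule ideal_of_closed)
    show "?N \<subseteq> carrier R" by (auto simp: localization_kernel_def)
    show "\<zero> \<in> ?N" using one by (auto simp: localization_kernel_def intro!: bexI[of _ \<one>])
    fix a assume "a \<in> ?N"
    then obtain s where a: "a \<in> carrier R" "s \<in> carrier R - m" "s \<otimes> a = \<zero>"
      by (auto simp: localization_kernel_def)
    { fix b assume "b \<in> ?N"
      then obtain t where b: "b \<in> carrier R" "t \<in> carrier R - m" "t \<otimes> b = \<zero>"
        by (auto simp: localization_kernel_def)
      have "(s \<otimes> t) \<otimes> (a \<oplus> b) = t \<otimes> (s \<otimes> a) \<oplus> s \<otimes> (t \<otimes> b)"
        using a(1,2) b(1,2) by (simp add: r_distr m_ac)
      also have "\<dots> = \<zero>" using a b by simp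
      finally show "a \<oplus> b \<in> ?N"
        using a b mult[OF a(2) b(2)] by (auto simp: localization_kernel_def) }
    fix r assume r: "r \<in> carrier R"
    have "s \<otimes> (r \<otimes> a) = r \<otimes> (s \<otimes> a)" using a(1,2) r by (simp add: m_ac)
    then show "r \<otimes> a \<in> ?N" using a r by (auto simp: localization_kernel_def)
  qed
  show sub: "?N \<subseteq> m"
    using primeideal_mem(2)[OF mp] ideal_closed(2)[OF mi] by (fastforce simp: localization_kernel_def)
  have rad: "m \<subseteq> ideal_radical R ?N"
  proof
    fix a assume am: "a \<in> m"
    then have a: "a \<in> carrier R" using mi ideal_closed(1) by blast
    obtain k :: nat and b where kb: "b \<in> carrier R" "a [^] k \<otimes> (\<one> \<ominus> a \<otimes> b) = \<zero>"
      using power_stable[OF a] .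
    have "\<one> \<ominus> a \<otimes> b \<notin> m"
    proof
      assume "\<one> \<ominus> a \<otimes> b \<in> m"
      then have "(\<one> \<ominus> a \<otimes> b) \<oplus> a \<otimes> b \<in> m"
        using ideal_closed(3,6)[OF mi] am kb by blast
      then show False using m1 a kb
        by (simp add: a_minus_def a_assoc l_neg)
    qed
    then have "a [^] k \<in> ?N"
      using kb a by (auto simp: localization_kernel_def m_comm[of _ "a [^] k"])
    then show "a \<in> ideal_radical R ?N" using a by (auto simp: ideal_radical_def)
  qed
  show prim: "primary_ideal R ?N"
    unfolding primary_ideal_def
  proof (intro conjI ballI impI)
    show "?N \<noteq> carrier R" using sub m1 by auto
    fix a b assume a: "a \<in> carrier R" and b: "b \<in> carrier R" and ab: "a \<otimes> b \<in> ?N"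
    then obtain s where s: "s \<in> carrier R - m" "s \<otimes> (a \<otimes> b) = \<zero>"
      by (auto simp: localization_kernel_def)
    have "(s \<otimes> b) \<otimes> a = \<zero>" using s a b by (simp add: m_ac)
    then show "a \<in> ?N \<or> b \<in> ideal_radical R ?N"
      using mult[OF s(1), of b] a b rad by (auto simp: localization_kernel_def)
  qed (rule N)
  show "ideal_radical R ?N = m"
    by (rule primary_radical_eq[OF prim m sub])
qed

lemma (in chain_cring) primary_decomposition_exists: "\<exists>Q. primary_decomposition R {\<zero>} Q"
proof -
  let ?N = "localization_kernel R"
  note Ni = primary_idealD(1)[OF localization_kernel(1)]
  let ?G = "{F. finite F \<and> (\<forall>m \<in> F. maximalideal m R)}"
  let ?I = "\<lambda>F. carrier R \<inter> \<Inter>(?N ` F)"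
  have G: "?I ` ?G \<noteq> {}" by auto
  have Gi: "J \<in> ?I ` ?G \<Longrightarrow> ideal J R" for J
    using Ni by (auto intro!: ideal_Int_Inter)
  obtain I where I: "I \<in> ?I ` ?G" and min: "\<forall>J \<in> ?I ` ?G. J \<subseteq> I \<longrightarrow> J = I"
    using minimal_ideal[OF G Gi] by (rule bexE)
  obtain F where IF: "I = ?I F" and F: "finite F" "\<And>m. m \<in> F \<Longrightarrow> maximalideal m R"
    using I by blast
  have zero: "?I F = {\<zero>}"
  proof (rule ccontr)
    assume "?I F \<noteq> {\<zero>}"
    moreover have "\<zero> \<in> ?I F" using ideal_closed(2)[OF Ni[OF F(2)]] by auto
    ultimately obtain a where a: "a \<in> ?I F" "a \<noteq> \<zero>" by blast
    let ?A = "{r \<in> carrier R. r \<otimes> a = \<zero>}"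
    have "ideal ?A R"
      by (rule ideal_of_closed) (use a in \<open>auto simp: l_distr m_assoc\<close>)
    moreover have "\<one> \<notin> ?A" using a by auto
    ultimately obtain m where m: "maximalideal m R" "?A \<subseteq> m"
      using ideal_le_maximal by blast
    have I_eq: "?I (insert m F) = I"
    proof (rule bspec[OF min, rule_format])
      show "?I (insert m F) \<in> ?I ` ?G" using F m by (intro imageI) auto
      show "?I (insert m F) \<subseteq> I" unfolding IF by auto
    qed
    have "a \<in> ?I (insert m F)" using a(1) unfolding I_eq IF .
    then have "a \<in> ?N m" by simp
    then show False using m(2) by (auto simp: localization_kernel_def)
  qed
  \<comment> \<open>This gives irredundancy: if the component at \<open>m\<close> were dropped and
    the intersection stayed zero, another component would lie below \<open>m\<close>.\<close>
  have uniq: "m' = m" if "maximalideal m R" "maximalideal m' R" "?N m' \<subseteq> m" for m m'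
    using primary_radical_eq[OF localization_kernel(1)[OF that(2)] that(1,3)]
      localization_kernel(3)[OF that(2)] by simp
  have "primary_decomposition R {\<zero>} (?N ` F)"
    unfolding primary_decomposition_def
  proof (intro conjI ballI)
    show "carrier R \<inter> \<Inter>(?N ` F - {q}) \<noteq> {\<zero>}" if qN: "q \<in> ?N ` F" for q
    proof
      obtain m where m: "m \<in> F" "q = ?N m" using qN by blast
      assume "carrier R \<inter> \<Inter>(?N ` F - {q}) = {\<zero>}"
      then have "carrier R \<inter> \<Inter>(?N ` F - {q}) \<subseteq> m"
        using ideal_closed(2)[OF maximal_idealD(2)[OF F(2)[OF m(1)]]] by simp
      then have "\<exists>q' \<in> ?N ` F - {q}. q' \<subseteq> m"
        using F Ni maximal_idealD(1)[OF F(2)[OF m(1)]]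
        by (intro prime_contains_Inter) auto
      then show False using uniq F m by blast
    qed
    show "inj_on (ideal_radical R) (?N ` F)"
      using localization_kernel(3) F(2) by (auto intro!: inj_onI)
  qed (use F zero localization_kernel(1) in auto)
  then show ?thesis ..
qed

text \<open>This is the fact that a nonzero ideal of an Artinian local ring meets the socle. Among
  the multiples \<open>f h\<close> outside \<open>q\<close>, one is taken whose ideal together with
  \<open>q\<close> is minimal. If \<open>x\<close> in the radical did not push it into
  \<open>q\<close>, the same ideal would be generated after multiplying by \<open>x\<close>, and a
  Nakayama argument applies.\<close>

lemma (in chain_cring) socle_multiple_modulo_primary:
  assumes q: "primary_ideal R q" and f: "f \<in> carrier R" "f \<notin> q"
  obtains h where "h \<in> carrier R" "f \<otimes> h \<notin> q" "\<And>x. x \<in> ideal_radical R q \<Longrightarrow> x \<otimes> (f \<otimes> h) \<in> q"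
proof -
  note qi = primary_idealD(1)[OF q] and m = primary_radical_maximal[OF q]
  note mi = maximal_idealD(2)[OF m]
  let ?H = "{h \<in> carrier R. f \<otimes> h \<notin> q}"
  let ?I = "\<lambda>h. PIdl (f \<otimes> h) <+>\<^bsub>R\<^esub> q"
  have "\<one> \<in> ?H" using f by simp
  then have H: "?I ` ?H \<noteq> {}" by blast
  have Hi: "J \<in> ?I ` ?H \<Longrightarrow> ideal J R" for J
    using f qi by (auto intro!: add_ideals cgenideal_ideal)
  obtain I where I: "I \<in> ?I ` ?H" and min: "\<forall>J \<in> ?I ` ?H. J \<subseteq> I \<longrightarrow> J = I"
    using minimal_ideal[OF H Hi] by (rule bexE)
  obtain h where Ih: "I = ?I h" and h: "h \<in> ?H"
    using I by blast
  show thesis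
  proof
    show hc: "h \<in> carrier R" and nq: "f \<otimes> h \<notin> q" using h by auto
    define n where "n = f \<otimes> h"
    have n: "n \<in> carrier R" using f hc by (simp add: n_def)
    fix x assume x: "x \<in> ideal_radical R q"
    then have xc: "x \<in> carrier R" using mi ideal_closed(1) by blast
    show "x \<otimes> (f \<otimes> h) \<in> q"
    proof (rule ccontr)
      assume "x \<otimes> (f \<otimes> h) \<notin> q"
      then have xh: "h \<otimes> x \<in> ?H" and eq: "f \<otimes> (h \<otimes> x) = x \<otimes> n"
        using f hc xc by (auto simp: m_ac n_def)
      have "PIdl (x \<otimes> n) \<subseteq> PIdl n"
        using n xc by (intro cgenideal_minimal cgenideal_ideal) (auto simp: cgenideal_def)
      then have "?I (h \<otimes> x) \<subseteq> ?I h"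
        unfolding eq n_def[symmetric] set_add_def' by auto
      then have "?I (h \<otimes> x) = ?I h" using bspec[OF min, of "?I (h \<otimes> x)"] xh unfolding Ih by blast
      moreover have "n \<in> ?I h"
        using set_add_memI[OF cgenideal_self[OF n] ideal_closed(2)[OF qi]] n
      unfolding n_def[symmetric] by simp
      ultimately have "n \<in> PIdl (x \<otimes> n) <+>\<^bsub>R\<^esub> q" by (simp add: eq)
      then obtain y z where yz: "y \<in> carrier R" "z \<in> q" "n = y \<otimes> (x \<otimes> n) \<oplus> z"
        unfolding set_add_def' cgenideal_def by auto
      have z: "z \<in> carrier R" using yz ideal_closed(1)[OF qi] by blast
      \<comment> \<open>From \<open>n = y x n + z\<close> with \<open>z\<close> in \<open>q\<close>,
        the product of \<open>n\<close> and \<open>1 - y x\<close> is in \<open>q\<close>. As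
        \<open>n\<close> is not, \<open>1 - y x\<close> is in the radical together with
        \<open>x\<close>, which would put one there.\<close>
      have "n \<otimes> (\<one> \<ominus> y \<otimes> x) = n \<ominus> y \<otimes> (x \<otimes> n)"
        using n yz(1) xc by (simp add: a_minus_def r_distr r_minus m_ac)
      also have "\<dots> = (y \<otimes> (x \<otimes> n) \<oplus> z) \<ominus> y \<otimes> (x \<otimes> n)" by (subst yz(3)) simp
      also have "\<dots> = z" using n yz(1) xc z by (simp add: a_minus_def a_ac r_neg r_neg1 r_neg2)
      finally have "n \<otimes> (\<one> \<ominus> y \<otimes> x) \<in> q" using yz by simp
      then have "\<one> \<ominus> y \<otimes> x \<in> ideal_radical R q"
        using primary_idealD(3)[OF q, of n "\<one> \<ominus> y \<otimes> x"] n yz(1) xc nq by (auto simp: n_def)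
      then have "(\<one> \<ominus> y \<otimes> x) \<oplus> y \<otimes> x \<in> ideal_radical R q"
        using ideal_closed(3,5)[OF mi] x yz by blast
      then show False using maximal_idealD(3)[OF m] xc yz
        by (simp add: a_minus_def a_assoc l_neg)
    qed
  qed
qed

section \<open>Gorenstein quotients\<close>

lemma (in Module.module) span_singleton:
  assumes x: "x \<in> carrier M"
  shows "span {x} = {a \<odot>\<^bsub>M\<^esub> x | a. a \<in> carrier R}"
proof -
  have "lincomb a {x} = a x \<odot>\<^bsub>M\<^esub> x" if "a x \<in> carrier R" for a
    using that x by (simp add: lincomb_def)
  moreover have "span {x} = {lincomb a {x} | a. a \<in> {x} \<rightarrow> carrier R}"
    by (rule finite_span) (use x in auto)
  moreover have "\<exists>b. a \<odot>\<^bsub>M\<^esub> x = b x \<odot>\<^bsub>M\<^esub> x \<and> b x \<in> carrier R" if "a \<in> carrier R" for a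
    using that by (intro exI[of _ "\<lambda>_. a"]) simp
  ultimately show ?thesis by force
qed

lemma (in ideal) rcos_eq_iff:
  assumes "a \<in> carrier R" "b \<in> carrier R"
  shows "I +>\<^bsub>R\<^esub> a = I +>\<^bsub>R\<^esub> b \<longleftrightarrow> a \<ominus>\<^bsub>R\<^esub> b \<in> I"
  using quotient_eq_iff_same_a_r_cos[OF is_ideal assms] by blast

lemma carrier_Quot: "carrier (R Quot I) = (\<lambda>a. I +>\<^bsub>R\<^esub> a) ` carrier R"
  by (auto simp: FactRing_def A_RCOSETS_def')

lemma zero_Quot: "\<zero>\<^bsub>R Quot I\<^esub> = I"
  by (simp add: FactRing_def)

section \<open>The socle as a vector space over the residue field\<close>

lemma socle_space_simps:
  "carrier (socle_space A m) = socle A m" "add (socle_space A m) = add A"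
  "zero (socle_space A m) = zero A"
  "smult (socle_space A m) = (\<lambda>C s. the_elem ((\<lambda>a. a \<otimes>\<^bsub>A\<^esub> s) ` C))"
  by (simp_all add: socle_space_def ring.defs module.defs)

lemma socle_space_smult:
  assumes "cring A" and m: "ideal m A" and a: "a \<in> carrier A" and s: "s \<in> socle A m"
  shows "(m +>\<^bsub>A\<^esub> a) \<odot>\<^bsub>socle_space A m\<^esub> s = a \<otimes>\<^bsub>A\<^esub> s"
proof -
  interpret cring A by fact
  interpret m: ideal m A by fact
  have "(x \<oplus>\<^bsub>A\<^esub> a) \<otimes>\<^bsub>A\<^esub> s = a \<otimes>\<^bsub>A\<^esub> s" if "x \<in> m" for x
    using that a s m.a_subset by (auto simp: socle_def l_distr)
  then have "(\<lambda>b. b \<otimes>\<^bsub>A\<^esub> s) ` (m +>\<^bsub>A\<^esub> a) = (\<lambda>x. a \<otimes>\<^bsub>A\<^esub> s) ` m"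
    unfolding a_r_coset_def' by (simp add: UNION_singleton_eq_range image_image)
  also have "\<dots> = {a \<otimes>\<^bsub>A\<^esub> s}"
    by (rule image_constant[OF m.zero_closed])
  finally have "(\<lambda>b. b \<otimes>\<^bsub>A\<^esub> s) ` (m +>\<^bsub>A\<^esub> a) = {a \<otimes>\<^bsub>A\<^esub> s}" .
  then show ?thesis by (simp add: socle_space_simps)
qed

lemma vectorspace_socle_space:
  assumes A: "cring A" and m: "maximalideal m A"
  shows "vectorspace (A Quot m) (socle_space A m)"
proof -
  interpret cring A by fact
  interpret m: maximalideal m A by fact
  interpret h: ring_hom_ring A "A Quot m" "\<lambda>a. m +>\<^bsub>A\<^esub> a" by (rule m.rcos_ring_hom_ring)
  note sm = socle_space_smult[OF A m.is_ideal]
  have mc: "x \<in> m \<Longrightarrow> x \<in> carrier A" for x using m.a_subset by blast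
  have sc: "s \<in> socle A m \<Longrightarrow> s \<in> carrier A" for s by (simp add: socle_def)
  have zero: "\<zero>\<^bsub>A\<^esub> \<in> socle A m" by (auto simp: socle_def mc)
  have add: "s \<oplus>\<^bsub>A\<^esub> t \<in> socle A m" if "s \<in> socle A m" "t \<in> socle A m" for s t
    using that mc by (auto simp: socle_def r_distr)
  have mult: "a \<otimes>\<^bsub>A\<^esub> s \<in> socle A m" if "a \<in> carrier A" "s \<in> socle A m" for a s
  proof -
    have "x \<otimes>\<^bsub>A\<^esub> (a \<otimes>\<^bsub>A\<^esub> s) = a \<otimes>\<^bsub>A\<^esub> (x \<otimes>\<^bsub>A\<^esub> s)" if "x \<in> m" for x
      using \<open>a \<in> carrier A\<close> sc[OF \<open>s \<in> socle A m\<close>] mc[OF that] by (simp add: m_lcomm)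
    then show ?thesis using that by (auto simp: socle_def)
  qed
  have neg: "\<ominus>\<^bsub>A\<^esub> s \<in> socle A m" if "s \<in> socle A m" for s
    using that mc by (auto simp: socle_def r_minus)
  show ?thesis
  proof (rule vs_criteria, unfold socle_space_simps(1-3))
    show "field (A Quot m)" by (rule m.quotient_is_field) (rule A)
    show "\<forall>v \<in> socle A m. \<exists>w \<in> socle A m. v \<oplus>\<^bsub>A\<^esub> w = \<zero>\<^bsub>A\<^esub>"
      using neg sc r_neg by blast
    show "\<forall>a b v. a \<in> carrier (A Quot m) \<and> b \<in> carrier (A Quot m) \<and> v \<in> socle A m \<longrightarrow>
      (a \<otimes>\<^bsub>A Quot m\<^esub> b) \<odot>\<^bsub>socle_space A m\<^esub> v =
        a \<odot>\<^bsub>socle_space A m\<^esub> (b \<odot>\<^bsub>socle_space A m\<^esub> v)"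
      by (auto simp: carrier_Quot h.hom_mult[symmetric] sm mult sc m_assoc
        simp del: h.hom_mult)
    show "\<forall>v \<in> socle A m. \<one>\<^bsub>A Quot m\<^esub> \<odot>\<^bsub>socle_space A m\<^esub> v = v"
      by (simp add: h.hom_one[symmetric] sm sc del: h.hom_one)
    show "\<forall>a b v. a \<in> carrier (A Quot m) \<and> b \<in> carrier (A Quot m) \<and> v \<in> socle A m \<longrightarrow>
      (a \<oplus>\<^bsub>A Quot m\<^esub> b) \<odot>\<^bsub>socle_space A m\<^esub> v =
        a \<odot>\<^bsub>socle_space A m\<^esub> v \<oplus>\<^bsub>A\<^esub> b \<odot>\<^bsub>socle_space A m\<^esub> v"
      by (auto simp: carrier_Quot h.hom_add[symmetric] sm mult sc l_distr
        simp del: h.hom_add)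
    show "\<forall>a v w. a \<in> carrier (A Quot m) \<and> v \<in> socle A m \<and> w \<in> socle A m \<longrightarrow>
      a \<odot>\<^bsub>socle_space A m\<^esub> (v \<oplus>\<^bsub>A\<^esub> w) =
        a \<odot>\<^bsub>socle_space A m\<^esub> v \<oplus>\<^bsub>A\<^esub> a \<odot>\<^bsub>socle_space A m\<^esub> w"
      by (auto simp: carrier_Quot sm mult add sc r_distr)
    show "\<forall>c v. c \<in> carrier (A Quot m) \<and> v \<in> socle A m \<longrightarrow> c \<odot>\<^bsub>socle_space A m\<^esub> v \<in> socle A m"
      by (auto simp: carrier_Quot sm mult)
  qed (use zero add sc in \<open>auto simp: a_ac\<close>)
qed

text \<open>Because \<open>m\<close> kills the socle, spanning it over the residue field is the same
  as generating it over \<open>A\<close>. This removes cosets and dimensions from the Gorenstein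
  condition.\<close>

lemma socle_space_dim_1_iff:
  assumes A: "cring A" and m: "maximalideal m A"
  shows "vectorspace.fin_dim (A Quot m) (socle_space A m) \<and>
      vectorspace.dim (A Quot m) (socle_space A m) = 1 \<longleftrightarrow>
    (\<exists>s \<in> socle A m. s \<noteq> \<zero>\<^bsub>A\<^esub> \<and> (\<forall>t \<in> socle A m. \<exists>a \<in> carrier A. t = a \<otimes>\<^bsub>A\<^esub> s))"
    (is "_ \<longleftrightarrow> ?R")
proof -
  interpret m: maximalideal m A by fact
  interpret S: vectorspace "A Quot m" "socle_space A m"
    by (rule vectorspace_socle_space[OF A m])
  note sm = socle_space_smult[OF A m.is_ideal]
  have span: "S.span {s} = {a \<otimes>\<^bsub>A\<^esub> s | a. a \<in> carrier A}" if "s \<in> socle A m" for s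
  proof -
    have "S.span {s} = {C \<odot>\<^bsub>socle_space A m\<^esub> s | C. C \<in> carrier (A Quot m)}"
      by (rule S.span_singleton) (use that in \<open>simp add: socle_space_simps\<close>)
    also have "\<dots> = (\<lambda>C. C \<odot>\<^bsub>socle_space A m\<^esub> s) ` (\<lambda>a. m +>\<^bsub>A\<^esub> a) ` carrier A"
      unfolding carrier_Quot[symmetric] by (rule Setcompr_eq_image)
    also have "\<dots> = (\<lambda>a. a \<otimes>\<^bsub>A\<^esub> s) ` carrier A"
      unfolding image_image by (rule image_cong[OF refl sm[OF _ that]])
    also have "\<dots> = {a \<otimes>\<^bsub>A\<^esub> s | a. a \<in> carrier A}"
      by (rule Setcompr_eq_image[symmetric])
    finally show ?thesis .
  qed
  show ?thesis
  proof
    assume "S.fin_dim \<and> S.dim = 1"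
    then obtain B where B: "finite B" "S.basis B" "card B = 1"
      using S.finite_basis_exists S.dim_basis by metis
    then obtain s where "B = {s}" by (auto simp: card_1_singleton_iff)
    then have s: "s \<in> socle A m" "S.span {s} = socle A m" "S.lin_indpt {s}"
      using B(2) by (auto simp: S.basis_def socle_space_simps)
    have "s \<noteq> \<zero>\<^bsub>A\<^esub>"
      using S.vs_zero_lin_dep[OF _ s(3)] s(1) by (auto simp: socle_space_simps)
    moreover have "\<exists>a \<in> carrier A. t = a \<otimes>\<^bsub>A\<^esub> s" if "t \<in> socle A m" for t
    proof -
      have "t \<in> S.span {s}" using that s(2) by simp
      then show ?thesis unfolding span[OF s(1)] by blast
    qed
    ultimately show ?R using s(1) by blast
  next
    assume ?R
    then obtain s where s: "s \<in> socle A m" "s \<noteq> \<zero>\<^bsub>A\<^esub>"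
      "\<And>t. t \<in> socle A m \<Longrightarrow> \<exists>a \<in> carrier A. t = a \<otimes>\<^bsub>A\<^esub> s" by blast
    have "S.span {s} \<subseteq> socle A m"
      using S.span_is_subset2[of "{s}"] s(1) by (simp add: socle_space_simps)
    then have gen: "S.gen_set {s}"
      using s(3) span[OF s(1)] by (auto simp: socle_space_simps)
    then have "S.fin_dim"
      unfolding S.fin_dim_def using s(1) by (intro exI[of _ "{s}"]) (simp add: socle_space_simps)
    moreover have "S.dim = 1"
      by (rule S.dim1I[OF gen]) (use s in \<open>simp_all add: socle_space_simps\<close>)
    ultimately show "S.fin_dim \<and> S.dim = 1" by blast
  qed
qed

section \<open>Quotients by primary ideals\<close>

lemma (in ideal) rcos_eq_zero_iff:
  "a \<in> carrier R \<Longrightarrow> I +>\<^bsub>R\<^esub> a = \<zero>\<^bsub>R Quot I\<^esub> \<longleftrightarrow> a \<in> I"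
  using rcos_const_imp_mem a_rcos_const by (metis zero_Quot)

lemma (in ideal) rcos_nat_pow:
  "a \<in> carrier R \<Longrightarrow> (I +>\<^bsub>R\<^esub> a) [^]\<^bsub>R Quot I\<^esub> (k::nat) = I +>\<^bsub>R\<^esub> (a [^]\<^bsub>R\<^esub> k)"
  using ring_hom_ring.hom_nat_pow[OF rcos_ring_hom_ring] by simp

text \<open>The counterpart of \<open>primary_radical_eq\<close>: now the power of \<open>a\<close>
  stays outside the radical, so the cofactor \<open>1 - a b\<close> of the vanishing product has to
  lie in \<open>q\<close>.\<close>

lemma (in chain_cring) unit_modulo_primary:
  assumes q: "primary_ideal R q" and a: "a \<in> carrier R" "a \<notin> ideal_radical R q"
  obtains b where "b \<in> carrier R" "\<one> \<ominus> a \<otimes> b \<in> q"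
proof -
  note m = maximal_idealD[OF primary_radical_maximal[OF q]]
  obtain k :: nat and b where kb: "b \<in> carrier R" "a [^] k \<otimes> (\<one> \<ominus> a \<otimes> b) = \<zero>"
    using power_stable[OF a(1)] .
  have "a [^] k \<notin> ideal_radical R q"
    using primeideal_mem(3)[OF m(1) a(1)] a(2) by blast
  moreover have "(\<one> \<ominus> a \<otimes> b) \<otimes> a [^] k \<in> q"
    using kb a ideal_closed(2)[OF primary_idealD(1)[OF q]] by (simp add: m_comm)
  ultimately have "\<one> \<ominus> a \<otimes> b \<in> q"
    using primary_idealD(3)[OF q, of "\<one> \<ominus> a \<otimes> b" "a [^] k"] kb a by auto
  then show thesis using that kb by blast
qed

context chain_cring
begin

context
  fixes q assumes q: "primary_ideal R q"
begin

interpretation qi: ideal q R by (rule primary_idealD(1)[OF q])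
interpretation h: ring_hom_cring R "R Quot q" "\<lambda>a. q +> a"
  by (rule qi.rcos_ring_hom_cring) (rule is_cring)

text \<open>Every class modulo \<open>q\<close> is nilpotent or a unit, according to whether its
  representative is in the radical. A prime contains all of the former and none of the latter, so it
  is determined.\<close>

lemma primeideal_quotient_eq:
  assumes p: "primeideal p (R Quot q)"
  shows "p = (\<lambda>a. q +> a) ` ideal_radical R q"
proof -
  interpret p: primeideal p "R Quot q" by fact
  have *: "q +> r \<in> p \<longleftrightarrow> r \<in> ideal_radical R q" if r: "r \<in> carrier R" for r
  proof
    assume "r \<in> ideal_radical R q"
    then obtain k :: nat where "r [^] k \<in> q" by (auto simp: ideal_radical_def)
    then have "(q +> r) [^]\<^bsub>R Quot q\<^esub> k = \<zero>\<^bsub>R Quot q\<^esub>"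
      using qi.rcos_nat_pow[OF r] qi.a_rcos_const by (simp add: zero_Quot)
    then show "q +> r \<in> p"
      using h.S.primeideal_mem(3)[OF p] r p.zero_closed by (metis h.hom_closed)
  next
    assume rp: "q +> r \<in> p"
    show "r \<in> ideal_radical R q"
    proof (rule ccontr)
      assume "r \<notin> ideal_radical R q"
      then obtain b where b: "b \<in> carrier R" "\<one> \<ominus> r \<otimes> b \<in> q"
        using unit_modulo_primary[OF q r] by blast
      then have "(q +> r) \<otimes>\<^bsub>R Quot q\<^esub> (q +> b) = \<one>\<^bsub>R Quot q\<^esub>"
        using r qi.rcos_eq_iff[of \<one> "r \<otimes> b"] by (metis h.hom_mult h.hom_one m_closed one_closed)
      moreover have "(q +> r) \<otimes>\<^bsub>R Quot q\<^esub> (q +> b) \<in> p"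
        using rp b by (intro p.I_r_closed) auto
      ultimately show False using h.S.primeideal_mem(1)[OF p] by metis
    qed
  qed
  have "p \<subseteq> (\<lambda>a. q +> a) ` carrier R"
    using p.a_subset unfolding carrier_Quot .
  moreover have "ideal_radical R q \<subseteq> carrier R" by (auto simp: ideal_radical_def)
  ultimately show ?thesis using * by blast
qed

lemma maximalideal_quotient:
  "maximalideal ((\<lambda>a. q +> a) ` ideal_radical R q) (R Quot q)"
proof -
  note m = maximal_idealD[OF primary_radical_maximal[OF q]]
  have I: "ideal ((\<lambda>a. q +> a) ` ideal_radical R q) (R Quot q)"
    by (rule ring_ideal_imp_quot_ideal[OF qi.is_ideal m(2)])
  have mem: "r \<in> ideal_radical R q"
    if r: "r \<in> carrier R" "q +> r \<in> (\<lambda>a. q +> a) ` ideal_radical R q" for r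
  proof -
    obtain x where x: "x \<in> ideal_radical R q" "q +> r = q +> x" using r by blast
    then have xc: "x \<in> carrier R" using ideal_closed(1)[OF m(2)] by blast
    then have "r \<ominus> x \<in> ideal_radical R q"
      using x r qi.rcos_eq_iff subset_radical[OF qi.is_ideal] by blast
    then have "(r \<ominus> x) \<oplus> x \<in> ideal_radical R q" using ideal_closed(3)[OF m(2)] x by blast
    then show ?thesis using r xc by (simp add: a_minus_def a_assoc l_neg)
  qed
  show ?thesis
  proof (rule maximalidealI[OF I])
    show "carrier (R Quot q) \<noteq> (\<lambda>a. q +> a) ` ideal_radical R q"
      using mem[of \<one>] m(3) unfolding carrier_Quot by blast
    fix J assume J: "ideal J (R Quot q)" "(\<lambda>a. q +> a) ` ideal_radical R q \<subseteq> J" "J \<subseteq> carrier (R Quot q)"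
    show "J = (\<lambda>a. q +> a) ` ideal_radical R q \<or> J = carrier (R Quot q)"
    proof (cases "J \<subseteq> (\<lambda>a. q +> a) ` ideal_radical R q")
      case False
      then obtain r where r: "r \<in> carrier R" "q +> r \<in> J" "r \<notin> ideal_radical R q"
        using J(3) unfolding carrier_Quot by blast
      then obtain b where b: "b \<in> carrier R" "\<one> \<ominus> r \<otimes> b \<in> q"
        using unit_modulo_primary[OF q] by blast
      then have "(q +> r) \<otimes>\<^bsub>R Quot q\<^esub> (q +> b) = \<one>\<^bsub>R Quot q\<^esub>"
        using r qi.rcos_eq_iff[of \<one> "r \<otimes> b"] by (metis h.hom_mult h.hom_one m_closed one_closed)
      moreover have "(q +> r) \<otimes>\<^bsub>R Quot q\<^esub> (q +> b) \<in> J"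
        using h.S.ideal_closed(6)[OF J(1) r(2)] b by simp
      ultimately have "J = carrier (R Quot q)" using h.S.ideal_closed(7)[OF J(1)] by simp
      then show ?thesis by blast
    qed (use J in blast)
  qed
qed

lemma local_krull_dim_zero_quotient:
  "local_ring (R Quot q) ((\<lambda>a. q +> a) ` ideal_radical R q)" "krull_dim_zero (R Quot q)"
  using maximalideal_quotient primeideal_quotient_eq h.S.maximal_idealD(1) h.S.is_cring
  unfolding local_ring_def krull_dim_zero_def by metis+

lemma socle_quotient:
  "socle (R Quot q) ((\<lambda>a. q +> a) ` ideal_radical R q) =
    (\<lambda>t. q +> t) ` {t \<in> carrier R. \<forall>x \<in> ideal_radical R q. x \<otimes> t \<in> q}"
proof -
  have "(q +> x) \<otimes>\<^bsub>R Quot q\<^esub> (q +> t) = \<zero>\<^bsub>R Quot q\<^esub> \<longleftrightarrow> x \<otimes> t \<in> q"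
    if "x \<in> ideal_radical R q" "t \<in> carrier R" for x t
  proof -
    have x: "x \<in> carrier R" using that by (auto simp: ideal_radical_def)
    have "(q +> x) \<otimes>\<^bsub>R Quot q\<^esub> (q +> t) = q +> (x \<otimes> t)" using x that by simp
    then show ?thesis
      using qi.rcos_eq_zero_iff[of "x \<otimes> t"] x that by simp
  qed
  note * = this
  let ?M = "ideal_radical R q"
  have "socle (R Quot q) ((\<lambda>a. q +> a) ` ?M) =
      {a \<in> (\<lambda>t. q +> t) ` carrier R. \<forall>x \<in> ?M. (q +> x) \<otimes>\<^bsub>R Quot q\<^esub> a = \<zero>\<^bsub>R Quot q\<^esub>}"
    unfolding socle_def carrier_Quot by (simp only: ball_simps)
  also have "\<dots> = (\<lambda>t. q +> t) `
      {t \<in> carrier R. \<forall>x \<in> ?M. (q +> x) \<otimes>\<^bsub>R Quot q\<^esub> (q +> t) = \<zero>\<^bsub>R Quot q\<^esub>}"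
    by (rule Compr_image_eq)
  also have "\<dots> = (\<lambda>t. q +> t) ` {t \<in> carrier R. \<forall>x \<in> ?M. x \<otimes> t \<in> q}"
    by (intro arg_cong2[of _ _ _ _ image] refl Collect_cong conj_cong ball_cong) (rule *)
  finally show ?thesis .
qed

text \<open>The condition is pulled back to elements of \<open>R\<close> and congruences modulo
  \<open>q\<close>, the form in which it is both established and used below. The choice of
  \<open>m\<close> disappears because the quotient has just one maximal ideal.\<close>

lemma gorenstein_quotient_iff:
  "(\<exists>m. gorenstein_local_ring (R Quot q) m) \<longleftrightarrow>
    (\<exists>s \<in> carrier R. s \<notin> q \<and> (\<forall>x \<in> ideal_radical R q. x \<otimes> s \<in> q) \<and>
      (\<forall>t \<in> carrier R. (\<forall>x \<in> ideal_radical R q. x \<otimes> t \<in> q) \<longrightarrow>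
        (\<exists>r \<in> carrier R. t \<ominus> r \<otimes> s \<in> q)))"
    (is "?L \<longleftrightarrow> ?R")
proof -
  let ?A = "R Quot q" and ?m = "(\<lambda>a. q +> a) ` ideal_radical R q"
  have "?L \<longleftrightarrow> gorenstein_local_ring ?A ?m"
    using maximalideal_quotient unfolding gorenstein_local_ring_def local_ring_def by metis
  also have "\<dots> \<longleftrightarrow> (\<exists>s \<in> socle ?A ?m. s \<noteq> \<zero>\<^bsub>?A\<^esub> \<and>
      (\<forall>t \<in> socle ?A ?m. \<exists>a \<in> carrier ?A. t = a \<otimes>\<^bsub>?A\<^esub> s))"
    unfolding gorenstein_local_ring_def
    using socle_space_dim_1_iff[OF h.S.is_cring maximalideal_quotient]
      local_krull_dim_zero_quotient by blast
  also have "\<dots> \<longleftrightarrow> ?R"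
  proof -
    let ?S = "{t \<in> carrier R. \<forall>x \<in> ideal_radical R q. x \<otimes> t \<in> q}"
    have zero: "q +> s \<noteq> \<zero>\<^bsub>?A\<^esub> \<longleftrightarrow> s \<notin> q" if "s \<in> carrier R" for s
      using qi.rcos_eq_zero_iff[OF that] by simp
    have "q +> t = (q +> a) \<otimes>\<^bsub>?A\<^esub> (q +> s) \<longleftrightarrow> t \<ominus> a \<otimes> s \<in> q"
      if "s \<in> carrier R" "t \<in> carrier R" "a \<in> carrier R" for a s t
      using that qi.rcos_eq_iff[of t "a \<otimes> s"] by simp
    then have mult: "(\<exists>a \<in> carrier ?A. q +> t = a \<otimes>\<^bsub>?A\<^esub> (q +> s)) \<longleftrightarrow>
        (\<exists>a \<in> carrier R. t \<ominus> a \<otimes> s \<in> q)"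
      if "s \<in> carrier R" "t \<in> carrier R" for s t
      using that unfolding carrier_Quot by (simp add: bex_simps)
    have "(\<exists>s \<in> socle ?A ?m. s \<noteq> \<zero>\<^bsub>?A\<^esub> \<and>
        (\<forall>t \<in> socle ?A ?m. \<exists>a \<in> carrier ?A. t = a \<otimes>\<^bsub>?A\<^esub> s)) \<longleftrightarrow>
      (\<exists>s \<in> ?S. q +> s \<noteq> \<zero>\<^bsub>?A\<^esub> \<and> (\<forall>t \<in> ?S. \<exists>a \<in> carrier ?A. q +> t = a \<otimes>\<^bsub>?A\<^esub> (q +> s)))"
      unfolding socle_quotient by (simp only: bex_simps ball_simps)
    also have "\<dots> \<longleftrightarrow> (\<exists>s \<in> ?S. s \<notin> q \<and> (\<forall>t \<in> ?S. \<exists>a \<in> carrier R. t \<ominus> a \<otimes> s \<in> q))"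
      by (intro bex_cong refl conj_cong ball_cong) (simp_all add: zero mult)
    also have "\<dots> \<longleftrightarrow> ?R" by blast
    finally show ?thesis .
  qed
  finally show ?thesis .
qed

end

end

section \<open>Finite-dimensional algebras\<close>

locale finite_dim_algebra =
  fixes K :: "'k ring" and R :: "('k, 'a) module"
  assumes field: "field K" and algebra: "algebra K R" and fin_dim: "vectorspace.fin_dim K R"

sublocale finite_dim_algebra \<subseteq> K: field K by (rule field)

sublocale finite_dim_algebra \<subseteq> R: cring R
  by (rule algebra.M_cring[OF algebra])

sublocale finite_dim_algebra \<subseteq> V: vectorspace K R
  using field algebra.module[OF algebra] by (simp add: vectorspace_def)

context finite_dim_algebra
begin

abbreviation functionals :: "('a \<Rightarrow> 'k) set" where
  "functionals \<equiv> module_hom K R (self_module K)"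

lemma smult_eq_mult:
  assumes "c \<in> carrier K" "x \<in> carrier R"
  shows "c \<odot>\<^bsub>R\<^esub> x = (c \<odot>\<^bsub>R\<^esub> \<one>\<^bsub>R\<^esub>) \<otimes>\<^bsub>R\<^esub> x"
  using algebra.smult_assoc2[OF algebra, of c "\<one>\<^bsub>R\<^esub>" x] assms by simp

lemma mult_smult:
  assumes "c \<in> carrier K" "x \<in> carrier R" "y \<in> carrier R"
  shows "x \<otimes>\<^bsub>R\<^esub> (c \<odot>\<^bsub>R\<^esub> y) = c \<odot>\<^bsub>R\<^esub> (x \<otimes>\<^bsub>R\<^esub> y)"
  using algebra.smult_assoc2[OF algebra, of c y x] assms by (simp add: R.m_comm)

lemma smult_mult:
  assumes "c \<in> carrier K" "x \<in> carrier R" "y \<in> carrier R"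
  shows "(c \<odot>\<^bsub>R\<^esub> x) \<otimes>\<^bsub>R\<^esub> y = c \<odot>\<^bsub>R\<^esub> (x \<otimes>\<^bsub>R\<^esub> y)"
  using algebra.smult_assoc2[OF algebra] assms by simp

lemma submodule_of_ideal:
  assumes "ideal I R"
  shows "submodule K I R"
proof (rule LinearCombinations.submodule.intro)
  show "Module.module K R" by (rule algebra.module[OF algebra])
  fix c v assume c: "c \<in> carrier K" and v: "v \<in> I"
  then have "v \<in> carrier R" using R.ideal_closed(1)[OF assms] by blast
  then show "c \<odot>\<^bsub>R\<^esub> v \<in> I"
    using R.ideal_closed(5)[OF assms v, of "c \<odot>\<^bsub>R\<^esub> \<one>\<^bsub>R\<^esub>"] c by (simp add: smult_eq_mult[of c v])
qed (use R.ideal_closed[OF assms] in auto)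

lemma chain_cring: "chain_cring R"
proof
  fix \<F> assume F: "\<F> \<noteq> {}" "\<And>I. I \<in> \<F> \<Longrightarrow> ideal I R"
  show "\<exists>I \<in> \<F>. \<forall>J \<in> \<F>. J \<subseteq> I \<longrightarrow> J = I"
    by (rule V.minimal_subspace[OF fin_dim F(1)]) (rule submodule_of_ideal[OF F(2)])
  show "\<exists>I \<in> \<F>. \<forall>J \<in> \<F>. I \<subseteq> J \<longrightarrow> J = I"
    by (rule V.maximal_subspace[OF fin_dim F(1)]) (rule submodule_of_ideal[OF F(2)])
qed

end

sublocale finite_dim_algebra \<subseteq> R: chain_cring R by (rule chain_cring)

context finite_dim_algebra
begin

section \<open>Nondegenerate and generating functionals\<close>

lemma functionalD:
  assumes "p \<in> functionals" "x \<in> carrier R"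
  shows "p x \<in> carrier K" "\<And>y. y \<in> carrier R \<Longrightarrow> p (x \<oplus>\<^bsub>R\<^esub> y) = p x \<oplus>\<^bsub>K\<^esub> p y"
    "\<And>c. c \<in> carrier K \<Longrightarrow> p (c \<odot>\<^bsub>R\<^esub> x) = c \<otimes>\<^bsub>K\<^esub> p x"
  using assms by (auto simp: LinearCombinations.module_hom_def)

lemma functional_zero:
  assumes "p \<in> functionals"
  shows "p \<zero>\<^bsub>R\<^esub> = \<zero>\<^bsub>K\<^esub>"
  using functionalD(1)[OF assms R.zero_closed]
    functionalD(3)[OF assms R.zero_closed, of "\<zero>\<^bsub>K\<^esub>"] by simp

lemma functionalI:
  assumes "\<And>x. x \<in> carrier R \<Longrightarrow> p x \<in> carrier K"
    "\<And>x y. x \<in> carrier R \<Longrightarrow> y \<in> carrier R \<Longrightarrow> p (x \<oplus>\<^bsub>R\<^esub> y) = p x \<oplus>\<^bsub>K\<^esub> p y"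
    "\<And>c x. c \<in> carrier K \<Longrightarrow> x \<in> carrier R \<Longrightarrow> p (c \<odot>\<^bsub>R\<^esub> x) = c \<otimes>\<^bsub>K\<^esub> p x"
  shows "p \<in> functionals"
  using assms by (auto simp: LinearCombinations.module_hom_def)

text \<open>This is the module action of \<open>f\<close> on \<open>p\<close>, without the
  restriction to the carrier that \<open>canonical_module\<close> adds.\<close>

lemma functional_translate:
  assumes p: "p \<in> functionals" and f: "f \<in> carrier R"
  shows "(\<lambda>g. p (f \<otimes>\<^bsub>R\<^esub> g)) \<in> functionals"
  by (rule functionalI)
    (use p f in \<open>simp_all add: functionalD R.r_distr mult_smult\<close>)

lemma functional_combination:
  assumes p: "p \<in> functionals" and f: "f \<in> functionals" and c: "c \<in> carrier K"
  shows "(\<lambda>x. p x \<oplus>\<^bsub>K\<^esub> c \<otimes>\<^bsub>K\<^esub> f x) \<in> functionals"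
  by (rule functionalI)
    (use p f c in \<open>simp_all add: functionalD K.r_distr K.a_ac K.m_ac\<close>)

definition nondegenerate :: "('a \<Rightarrow> 'k) \<Rightarrow> bool" where
  "nondegenerate \<phi> \<longleftrightarrow> (\<forall>f \<in> carrier R. (\<forall>g \<in> carrier R. \<phi> (f \<otimes>\<^bsub>R\<^esub> g) = \<zero>\<^bsub>K\<^esub>) \<longrightarrow> f = \<zero>\<^bsub>R\<^esub>)"

text \<open>Equality is tested on the carrier only and \<open>\<psi>\<close> need not be
  extensional, so that extensionality matters only in the comparison with
  \<open>canonical_module\<close>.\<close>

definition generating :: "('a \<Rightarrow> 'k) \<Rightarrow> bool" where
  "generating \<phi> \<longleftrightarrow>
    (\<forall>\<psi> \<in> functionals. \<exists>f \<in> carrier R. \<forall>g \<in> carrier R. \<psi> g = \<phi> (f \<otimes>\<^bsub>R\<^esub> g))"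

text \<open>An \<open>f\<close> that annihilates \<open>\<phi>\<close> is a zero of every translate
  of \<open>\<phi>\<close>, by commutativity. If the translates are all functionals, then
  \<open>f\<close> is zero, since functionals separate points.\<close>

lemma nondegenerate_of_generating:
  assumes "generating \<phi>"
  shows "nondegenerate \<phi>"
  unfolding nondegenerate_def
proof (intro ballI impI, rule ccontr)
  fix f assume f: "f \<in> carrier R" "\<forall>g \<in> carrier R. \<phi> (f \<otimes>\<^bsub>R\<^esub> g) = \<zero>\<^bsub>K\<^esub>" "f \<noteq> \<zero>\<^bsub>R\<^esub>"
  have "f \<notin> {\<zero>\<^bsub>R\<^esub>}" using f by simp
  then obtain \<psi> where \<psi>: "\<psi> \<in> functionals" "\<psi> f \<noteq> \<zero>\<^bsub>K\<^esub>"
    using functional_separating[OF V.vectorspace_axioms fin_dim submodule_of_ideal[OF R.zeroideal] f(1)]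
    by metis
  obtain h where h: "h \<in> carrier R" "\<forall>g \<in> carrier R. \<psi> g = \<phi> (h \<otimes>\<^bsub>R\<^esub> g)"
    using assms \<psi>(1) unfolding generating_def by blast
  then have "\<psi> f = \<phi> (f \<otimes>\<^bsub>R\<^esub> h)" using f(1) by (simp add: R.m_comm)
  then show False using f h \<psi> by simp
qed

text \<open>Nondegeneracy says that the common kernel of all translates of \<open>\<phi>\<close> is
  zero. A minimal common kernel of finitely many translates is then zero already, so any functional
  vanishes on it and belongs to \<open>E\<close>, the set of translates.\<close>

lemma generating_of_nondegenerate:
  assumes \<phi>: "\<phi> \<in> functionals" and nd: "nondegenerate \<phi>"
  shows "generating \<phi>"
proof -
  define E where "E = {p \<in> functionals. \<exists>h \<in> carrier R. \<forall>x \<in> carrier R. p x = \<phi> (h \<otimes>\<^bsub>R\<^esub> x)}"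
  let ?k = "\<lambda>F. {x \<in> carrier R. \<forall>p \<in> F. p x = \<zero>\<^bsub>K\<^esub>}"
  let ?G = "{F. finite F \<and> F \<subseteq> E}"
  have sub: "submodule K (?k F) R" if "F \<subseteq> E" for F
  proof (rule LinearCombinations.submodule.intro)
    show "Module.module K R" by (rule algebra.module[OF algebra])
    have *: "p \<in> functionals" if "p \<in> F" for p using that \<open>F \<subseteq> E\<close> by (auto simp: E_def)
    show "\<zero>\<^bsub>R\<^esub> \<in> ?k F" using functional_zero[OF *] by simp
    fix v assume v: "v \<in> ?k F"
    then have pv: "v \<in> carrier R" "\<And>p. p \<in> F \<Longrightarrow> p v = \<zero>\<^bsub>K\<^esub>" by auto
    { fix w assume w: "w \<in> ?k F"
      have "p (v \<oplus>\<^bsub>R\<^esub> w) = \<zero>\<^bsub>K\<^esub>" if "p \<in> F" for p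
      proof -
        have "p v = \<zero>\<^bsub>K\<^esub>" "p w = \<zero>\<^bsub>K\<^esub>" using that v w by auto
        then show ?thesis using functionalD(2)[OF *[OF that] pv(1), of w] w by simp
      qed
      then show "v \<oplus>\<^bsub>R\<^esub> w \<in> ?k F" using v w by simp }
    fix c assume c: "c \<in> carrier K"
    have "p (c \<odot>\<^bsub>R\<^esub> v) = \<zero>\<^bsub>K\<^esub>" if "p \<in> F" for p
      using functionalD(3)[OF *[OF that] pv(1) c] pv(2)[OF that] c by simp
    then show "c \<odot>\<^bsub>R\<^esub> v \<in> ?k F" using pv(1) c by simp
  qed auto
  have G: "?k ` ?G \<noteq> {}" by auto
  have Gs: "W \<in> ?k ` ?G \<Longrightarrow> submodule K W R" for W using sub by auto
  obtain W where W: "W \<in> ?k ` ?G" and min: "\<forall>W' \<in> ?k ` ?G. W' \<subseteq> W \<longrightarrow> W' = W"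
    using V.minimal_subspace[OF fin_dim G Gs] by (rule bexE)
  obtain F where WF: "W = ?k F" and F: "finite F" "F \<subseteq> E" using W by blast
  have zero: "x = \<zero>\<^bsub>R\<^esub>" if x: "x \<in> ?k F" for x
  proof (rule ccontr)
    assume nz: "x \<noteq> \<zero>\<^bsub>R\<^esub>"
    have xc: "x \<in> carrier R" using x by simp
    obtain h where h: "h \<in> carrier R" "\<phi> (x \<otimes>\<^bsub>R\<^esub> h) \<noteq> \<zero>\<^bsub>K\<^esub>"
      using nd nz xc unfolding nondegenerate_def by blast
    \<comment> \<open>Some translate of \<open>\<phi>\<close> does not vanish at \<open>x\<close>;
      adding it to \<open>F\<close> would shrink a kernel that is minimal.\<close>
    let ?p = "\<lambda>g. \<phi> (h \<otimes>\<^bsub>R\<^esub> g)"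
    have "?p \<in> E" using functional_translate[OF \<phi> h(1)] h(1) by (auto simp: E_def)
    then have mem: "?k (insert ?p F) \<in> ?k ` ?G" using F by (intro imageI) auto
    have le: "?k (insert ?p F) \<subseteq> W" unfolding WF by auto
    have "?k (insert ?p F) = W" by (rule mp[OF bspec[OF min mem] le])
    then have "x \<in> ?k (insert ?p F)" using x unfolding WF by simp
    then show False using h xc by (simp add: R.m_comm)
  qed
  show ?thesis
    unfolding generating_def
  proof
    fix \<psi> assume \<psi>: "\<psi> \<in> functionals"
    have "\<exists>h \<in> E. \<forall>x \<in> carrier R. \<psi> x = h x"
    proof (rule functional_in_of_common_kernel[OF V.vectorspace_axioms _ _ _ F \<psi>])
      show "E \<subseteq> functionals" by (auto simp: E_def)
      show "(\<lambda>x. \<zero>\<^bsub>K\<^esub>) \<in> E"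
        using functional_zero[OF \<phi>] by (auto simp: E_def intro!: functionalI bexI[of _ "\<zero>\<^bsub>R\<^esub>"])
      show "(\<lambda>x. p x \<oplus>\<^bsub>K\<^esub> c \<otimes>\<^bsub>K\<^esub> f x) \<in> E" if "p \<in> E" "f \<in> E" and c: "c \<in> carrier K" for p f c
      proof -
        obtain h where h: "h \<in> carrier R" "\<And>x. x \<in> carrier R \<Longrightarrow> p x = \<phi> (h \<otimes>\<^bsub>R\<^esub> x)"
          using \<open>p \<in> E\<close> by (auto simp: E_def)
        obtain k where k: "k \<in> carrier R" "\<And>x. x \<in> carrier R \<Longrightarrow> f x = \<phi> (k \<otimes>\<^bsub>R\<^esub> x)"
          using \<open>f \<in> E\<close> by (auto simp: E_def)
        have "p x \<oplus>\<^bsub>K\<^esub> c \<otimes>\<^bsub>K\<^esub> f x = \<phi> ((h \<oplus>\<^bsub>R\<^esub> c \<odot>\<^bsub>R\<^esub> k) \<otimes>\<^bsub>R\<^esub> x)" if "x \<in> carrier R" for x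
          using that h k c functionalD[OF \<phi>] by (simp add: R.l_distr smult_mult)
        moreover have "h \<oplus>\<^bsub>R\<^esub> c \<odot>\<^bsub>R\<^esub> k \<in> carrier R" using h k c by simp
        moreover have "(\<lambda>x. p x \<oplus>\<^bsub>K\<^esub> c \<otimes>\<^bsub>K\<^esub> f x) \<in> functionals"
          using functional_combination c that by (auto simp: E_def)
        ultimately show ?thesis unfolding E_def by blast
      qed
      show "\<psi> x = \<zero>\<^bsub>K\<^esub>" if "x \<in> carrier R" "\<And>f. f \<in> F \<Longrightarrow> f x = \<zero>\<^bsub>K\<^esub>" for x
        using zero[of x] that functional_zero[OF \<psi>] by simp
    qed
    then show "\<exists>f \<in> carrier R. \<forall>g \<in> carrier R. \<psi> g = \<phi> (f \<otimes>\<^bsub>R\<^esub> g)"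
      unfolding E_def by fastforce
  qed
qed

text \<open>With \<open>M\<close> the radical of \<open>q\<close> and \<open>e\<close> the idempotent of the component, every socle element of
  the quotient by \<open>q\<close> lifts to \<open>t\<close> with \<open>M t = 0\<close>.  If \<open>t\<close> were not a multiple of another such
  \<open>s \<noteq> 0\<close>, a functional \<open>\<psi> = f \<phi>\<close> could vanish on the ideal of \<open>s\<close> but not at \<open>t\<close>;
  nondegeneracy then gives \<open>f s = 0\<close>, so \<open>f\<close> lies in \<open>M\<close> and \<open>\<psi> t = \<phi> (f t) = 0\<close>.\<close>

lemma locally_gorenstein_of_nondegenerate:
  assumes \<phi>: "\<phi> \<in> functionals" and nd: "nondegenerate \<phi>"
  shows "locally_gorenstein R"
proof -
  have gen: "generating \<phi>" by (rule generating_of_nondegenerate[OF assms])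
  obtain Q where Q: "primary_decomposition R {\<zero>\<^bsub>R\<^esub>} Q"
    using R.primary_decomposition_exists by blast
  have "\<exists>m. gorenstein_local_ring (R Quot q) m" if qQ: "q \<in> Q" for q
  proof -
    have q: "primary_ideal R q" using Q qQ by (auto simp: primary_decomposition_def)
    note qi = R.primary_idealD(1)[OF q] and m = R.maximal_idealD[OF R.primary_radical_maximal[OF q]]
    let ?M = "ideal_radical R q"
    have Mc: "x \<in> carrier R" if "x \<in> ?M" for x using that R.ideal_closed(1)[OF m(2)] by blast
    obtain e where e: "e \<in> carrier R" "\<one>\<^bsub>R\<^esub> \<ominus>\<^bsub>R\<^esub> e \<in> q" "\<And>x. x \<in> q \<Longrightarrow> e \<otimes>\<^bsub>R\<^esub> x = \<zero>\<^bsub>R\<^esub>"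
      using R.decomposition_idempotent[OF Q qQ] by metis
    have e_diff: "t \<ominus>\<^bsub>R\<^esub> e \<otimes>\<^bsub>R\<^esub> t \<in> q" if "t \<in> carrier R" for t
      using R.ideal_closed(6)[OF qi e(2) that] that e(1)
      by (simp add: R.l_distr R.l_minus a_minus_def)
    have kill: "x \<otimes>\<^bsub>R\<^esub> (e \<otimes>\<^bsub>R\<^esub> t) = \<zero>\<^bsub>R\<^esub>"
      if "x \<in> ?M" "t \<in> carrier R" "\<And>x. x \<in> ?M \<Longrightarrow> x \<otimes>\<^bsub>R\<^esub> t \<in> q" for x t
      using e(3)[OF that(3)[OF that(1)]] that(2) Mc[OF that(1)] e(1) by (simp add: R.m_lcomm)
    obtain s where s: "s \<in> carrier R" "s \<notin> q" "\<And>x. x \<in> ?M \<Longrightarrow> x \<otimes>\<^bsub>R\<^esub> s \<in> q"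
      using R.socle_multiple_modulo_primary[OF q R.one_closed R.primary_idealD(2)[OF q]]
      by (metis R.l_one)
    \<comment> \<open>Multiplying by \<open>e\<close> keeps the class modulo \<open>q\<close> but
      makes products with elements of \<open>?M\<close> vanish in \<open>R\<close> itself, not only
      modulo \<open>q\<close>.\<close>
    define s' where "s' = e \<otimes>\<^bsub>R\<^esub> s"
    have s'c: "s' \<in> carrier R" using e s by (simp add: s'_def)
    have s'q: "s' \<notin> q"
    proof
      assume "s' \<in> q"
      then have "(s \<ominus>\<^bsub>R\<^esub> s') \<oplus>\<^bsub>R\<^esub> s' \<in> q"
        using R.ideal_closed(3)[OF qi] e_diff[OF s(1)] by (simp add: s'_def)
      then show False using s s'c by (simp add: a_minus_def R.a_assoc R.l_neg)
    qed
    have mult: "\<exists>r \<in> carrier R. t \<ominus>\<^bsub>R\<^esub> r \<otimes>\<^bsub>R\<^esub> s \<in> q"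
      if t: "t \<in> carrier R" "\<And>x. x \<in> ?M \<Longrightarrow> x \<otimes>\<^bsub>R\<^esub> t \<in> q" for t
    proof -
      let ?t = "e \<otimes>\<^bsub>R\<^esub> t"
      have tc: "?t \<in> carrier R" using e t by simp
      have P: "ideal (PIdl\<^bsub>R\<^esub> s') R" by (rule R.cgenideal_ideal[OF s'c])
      have "?t \<in> PIdl\<^bsub>R\<^esub> s'"
      proof (rule ccontr)
        assume nt: "?t \<notin> PIdl\<^bsub>R\<^esub> s'"
        obtain \<psi> where \<psi>: "\<psi> \<in> functionals" "\<And>w. w \<in> PIdl\<^bsub>R\<^esub> s' \<Longrightarrow> \<psi> w = \<zero>\<^bsub>K\<^esub>" "\<psi> ?t \<noteq> \<zero>\<^bsub>K\<^esub>"
          using functional_separating[OF V.vectorspace_axioms fin_dim submodule_of_ideal[OF P] tc nt]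
          by metis
        obtain f where f: "f \<in> carrier R" "\<And>g. g \<in> carrier R \<Longrightarrow> \<psi> g = \<phi> (f \<otimes>\<^bsub>R\<^esub> g)"
          using gen \<psi>(1) unfolding generating_def by blast
        have "\<phi> (f \<otimes>\<^bsub>R\<^esub> s' \<otimes>\<^bsub>R\<^esub> g) = \<zero>\<^bsub>K\<^esub>" if g: "g \<in> carrier R" for g
        proof -
          have "g \<otimes>\<^bsub>R\<^esub> s' \<in> PIdl\<^bsub>R\<^esub> s'" using g by (auto simp: cgenideal_def)
          then have "\<phi> (f \<otimes>\<^bsub>R\<^esub> (g \<otimes>\<^bsub>R\<^esub> s')) = \<zero>\<^bsub>K\<^esub>"
            using \<psi>(2) f(2)[of "g \<otimes>\<^bsub>R\<^esub> s'"] g s'c by simp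
          then show ?thesis using f(1) g s'c by (simp add: R.m_ac)
        qed
        then have "f \<otimes>\<^bsub>R\<^esub> s' = \<zero>\<^bsub>R\<^esub>"
          using nd f(1) s'c unfolding nondegenerate_def by simp
        then have "s' \<otimes>\<^bsub>R\<^esub> f \<in> q"
          using R.ideal_closed(2)[OF qi] f(1) s'c by (simp add: R.m_comm)
        then have "f \<in> ?M" using R.primary_idealD(3)[OF q s'c f(1)] s'q by blast
        then have "f \<otimes>\<^bsub>R\<^esub> ?t = \<zero>\<^bsub>R\<^esub>" using kill t by blast
        then show False using \<psi>(3) f(2)[OF tc] functional_zero[OF \<phi>] by simp
      qed
      then obtain r where r: "r \<in> carrier R" "?t = r \<otimes>\<^bsub>R\<^esub> s'" by (auto simp: cgenideal_def)
      \<comment> \<open>Back from the equation in \<open>R\<close> to a congruence: modulo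
        \<open>q\<close>, \<open>e\<close> acts as one, so \<open>t\<close> is congruent to
        \<open>?t = r s'\<close>, which is congruent to \<open>r s\<close>.\<close>
      have rs: "r \<otimes>\<^bsub>R\<^esub> s \<ominus>\<^bsub>R\<^esub> ?t \<in> q"
        using R.ideal_closed(5)[OF qi e_diff[OF s(1)] r(1)] r s s'c e(1)
        by (simp add: s'_def a_minus_def R.r_distr R.r_minus)
      have "(t \<ominus>\<^bsub>R\<^esub> ?t) \<ominus>\<^bsub>R\<^esub> (r \<otimes>\<^bsub>R\<^esub> s \<ominus>\<^bsub>R\<^esub> ?t) \<in> q"
        by (rule R.ideal_closed(4)[OF qi e_diff[OF t(1)] rs])
      moreover have "(t \<ominus>\<^bsub>R\<^esub> ?t) \<ominus>\<^bsub>R\<^esub> (r \<otimes>\<^bsub>R\<^esub> s \<ominus>\<^bsub>R\<^esub> ?t) = t \<ominus>\<^bsub>R\<^esub> r \<otimes>\<^bsub>R\<^esub> s"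
        using t(1) tc r(1) s(1)
        by (simp add: a_minus_def R.minus_add R.a_ac R.r_neg R.r_neg1 R.r_neg2)
      ultimately show ?thesis using r(1) by auto
    qed
    show ?thesis
      unfolding R.gorenstein_quotient_iff[OF q]
    proof (rule bexI[OF _ s(1)], intro conjI ballI impI)
      show "s \<notin> q" by (rule s(2))
      show "x \<otimes>\<^bsub>R\<^esub> s \<in> q" if "x \<in> ?M" for x by (rule s(3)[OF that])
      show "\<exists>r \<in> carrier R. t \<ominus>\<^bsub>R\<^esub> r \<otimes>\<^bsub>R\<^esub> s \<in> q"
        if "t \<in> carrier R" "\<forall>x \<in> ?M. x \<otimes>\<^bsub>R\<^esub> t \<in> q" for t
        by (rule mult[OF that(1)]) (rule bspec[OF that(2)])
    qed
  qed
  then show ?thesis unfolding locally_gorenstein_def using Q by blast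
qed

text \<open>The functional is the sum over the components of functionals that do not vanish on the socle:
  every nonzero ideal contains such a socle.\<close>

lemma nondegenerate_of_locally_gorenstein:
  assumes "locally_gorenstein R"
  obtains \<phi> where "\<phi> \<in> functionals" "nondegenerate \<phi>"
proof -
  obtain Q where Q: "primary_decomposition R {\<zero>\<^bsub>R\<^esub>} Q"
    and gor: "\<And>q. q \<in> Q \<Longrightarrow> \<exists>m. gorenstein_local_ring (R Quot q) m"
    using assms unfolding locally_gorenstein_def by blast
  have fin: "finite Q" and prim: "\<And>q. q \<in> Q \<Longrightarrow> primary_ideal R q"
    and int: "carrier R \<inter> \<Inter>Q = {\<zero>\<^bsub>R\<^esub>}"
    using Q by (auto simp: primary_decomposition_def)
  note qi = R.primary_idealD(1)[OF prim]
  \<comment> \<open>All requirements on one component are bundled so that idempotent, socle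
    generator and functional can be chosen together for every \<open>q\<close>.\<close>
  define P where "P q e s l \<longleftrightarrow> e \<in> carrier R \<and> \<one>\<^bsub>R\<^esub> \<ominus>\<^bsub>R\<^esub> e \<in> q \<and>
    (\<forall>q' \<in> Q. q' \<noteq> q \<longrightarrow> e \<in> q') \<and> (\<forall>x \<in> q. e \<otimes>\<^bsub>R\<^esub> x = \<zero>\<^bsub>R\<^esub>) \<and> s \<in> carrier R \<and> s \<notin> q \<and>
    (\<forall>t \<in> carrier R. (\<forall>x \<in> ideal_radical R q. x \<otimes>\<^bsub>R\<^esub> t \<in> q) \<longrightarrow>
      (\<exists>r \<in> carrier R. t \<ominus>\<^bsub>R\<^esub> r \<otimes>\<^bsub>R\<^esub> s \<in> q)) \<and>
    (\<forall>x \<in> ideal_radical R q. x \<otimes>\<^bsub>R\<^esub> s \<in> q) \<and>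
    l \<in> functionals \<and> l (e \<otimes>\<^bsub>R\<^esub> s) \<noteq> \<zero>\<^bsub>K\<^esub>" for q e s l
  have "\<exists>e s l. P q e s l" if q: "q \<in> Q" for q
  proof -
    obtain e where e: "e \<in> carrier R" "\<one>\<^bsub>R\<^esub> \<ominus>\<^bsub>R\<^esub> e \<in> q" "\<And>q'. q' \<in> Q \<Longrightarrow> q' \<noteq> q \<Longrightarrow> e \<in> q'"
      "\<And>x. x \<in> q \<Longrightarrow> e \<otimes>\<^bsub>R\<^esub> x = \<zero>\<^bsub>R\<^esub>"
      using R.decomposition_idempotent[OF Q q] by metis
    obtain s where s: "s \<in> carrier R" "s \<notin> q" "\<forall>x \<in> ideal_radical R q. x \<otimes>\<^bsub>R\<^esub> s \<in> q"
      "\<forall>t \<in> carrier R. (\<forall>x \<in> ideal_radical R q. x \<otimes>\<^bsub>R\<^esub> t \<in> q) \<longrightarrow>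
        (\<exists>r \<in> carrier R. t \<ominus>\<^bsub>R\<^esub> r \<otimes>\<^bsub>R\<^esub> s \<in> q)"
      using gor[OF q] unfolding R.gorenstein_quotient_iff[OF prim[OF q]] by blast
    have es: "e \<otimes>\<^bsub>R\<^esub> s \<in> carrier R" using e s by simp
    have "e \<otimes>\<^bsub>R\<^esub> s \<noteq> \<zero>\<^bsub>R\<^esub>"
    proof
      assume *: "e \<otimes>\<^bsub>R\<^esub> s = \<zero>\<^bsub>R\<^esub>"
      have "(\<one>\<^bsub>R\<^esub> \<ominus>\<^bsub>R\<^esub> e) \<otimes>\<^bsub>R\<^esub> s = s \<ominus>\<^bsub>R\<^esub> e \<otimes>\<^bsub>R\<^esub> s"
        using e(1) s(1) by (simp add: R.l_distr R.l_minus a_minus_def)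
      then have "(\<one>\<^bsub>R\<^esub> \<ominus>\<^bsub>R\<^esub> e) \<otimes>\<^bsub>R\<^esub> s = s" using * s(1) by (simp add: a_minus_def)
      then show False using R.ideal_closed(6)[OF qi[OF q] e(2) s(1)] s(2) by simp
    qed
    then have "e \<otimes>\<^bsub>R\<^esub> s \<notin> {\<zero>\<^bsub>R\<^esub>}" by simp
    then obtain l where "l \<in> functionals" "l (e \<otimes>\<^bsub>R\<^esub> s) \<noteq> \<zero>\<^bsub>K\<^esub>"
      using functional_separating[OF V.vectorspace_axioms fin_dim submodule_of_ideal[OF R.zeroideal] es]
      by metis
    then have "P q e s l" using e s unfolding P_def by blast
    then show ?thesis by blast
  qed
  then obtain e s l where Pq: "\<And>q. q \<in> Q \<Longrightarrow> P q (e q) (s q) (l q)" by metis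
  have e: "e q \<in> carrier R" and e1: "\<one>\<^bsub>R\<^esub> \<ominus>\<^bsub>R\<^esub> e q \<in> q" and e0: "\<And>x. x \<in> q \<Longrightarrow> e q \<otimes>\<^bsub>R\<^esub> x = \<zero>\<^bsub>R\<^esub>"
    and eq': "\<And>q'. q' \<in> Q \<Longrightarrow> q' \<noteq> q \<Longrightarrow> e q \<in> q'" and s: "s q \<in> carrier R" "s q \<notin> q"
    and sM: "\<And>x. x \<in> ideal_radical R q \<Longrightarrow> x \<otimes>\<^bsub>R\<^esub> s q \<in> q"
    and gen: "\<And>t. t \<in> carrier R \<Longrightarrow> (\<And>x. x \<in> ideal_radical R q \<Longrightarrow> x \<otimes>\<^bsub>R\<^esub> t \<in> q) \<Longrightarrow>
        \<exists>r \<in> carrier R. t \<ominus>\<^bsub>R\<^esub> r \<otimes>\<^bsub>R\<^esub> s q \<in> q"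
    and l: "l q \<in> functionals" "l q (e q \<otimes>\<^bsub>R\<^esub> s q) \<noteq> \<zero>\<^bsub>K\<^esub>" if "q \<in> Q" for q
    using Pq[OF that] unfolding P_def by auto
  have le: "(\<lambda>g. l q (e q \<otimes>\<^bsub>R\<^esub> g)) \<in> functionals" if "q \<in> Q" for q
    by (rule functional_translate[OF l(1)[OF that] e[OF that]])
  \<comment> \<open>The factor \<open>e q\<close> confines each summand to its own component: on
    multiples of another component's idempotent the summand vanishes.\<close>
  define \<phi> where "\<phi> g = (\<Oplus>\<^bsub>K\<^esub> q \<in> Q. l q (e q \<otimes>\<^bsub>R\<^esub> g))" for g
  have \<phi>: "\<phi> \<in> functionals"
  proof (rule functionalI)
    show "\<phi> x \<in> carrier K" if "x \<in> carrier R" for x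
      unfolding \<phi>_def using functionalD(1)[OF le that] by (intro K.finsum_closed) auto
    show "\<phi> (x \<oplus>\<^bsub>R\<^esub> y) = \<phi> x \<oplus>\<^bsub>K\<^esub> \<phi> y" if "x \<in> carrier R" "y \<in> carrier R" for x y
    proof -
      have "\<phi> (x \<oplus>\<^bsub>R\<^esub> y) = (\<Oplus>\<^bsub>K\<^esub> q \<in> Q. l q (e q \<otimes>\<^bsub>R\<^esub> x) \<oplus>\<^bsub>K\<^esub> l q (e q \<otimes>\<^bsub>R\<^esub> y))"
        unfolding \<phi>_def using functionalD(1,2)[OF le] that by (intro K.finsum_cong') auto
      also have "\<dots> = \<phi> x \<oplus>\<^bsub>K\<^esub> \<phi> y"
        unfolding \<phi>_def using functionalD(1)[OF le] that by (intro K.finsum_addf) auto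
      finally show ?thesis .
    qed
    show "\<phi> (c \<odot>\<^bsub>R\<^esub> x) = c \<otimes>\<^bsub>K\<^esub> \<phi> x" if "c \<in> carrier K" "x \<in> carrier R" for c x
    proof -
      have "\<phi> (c \<odot>\<^bsub>R\<^esub> x) = (\<Oplus>\<^bsub>K\<^esub> q \<in> Q. c \<otimes>\<^bsub>K\<^esub> l q (e q \<otimes>\<^bsub>R\<^esub> x))"
        unfolding \<phi>_def using functionalD(1,3)[OF le] that by (intro K.finsum_cong') auto
      also have "\<dots> = c \<otimes>\<^bsub>K\<^esub> \<phi> x"
        unfolding \<phi>_def using functionalD(1)[OF le] that fin by (intro K.finsum_rdistr[symmetric]) auto
      finally show ?thesis .
    qed
  qed
  have "nondegenerate \<phi>"
    unfolding nondegenerate_def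
  proof (intro ballI impI, rule ccontr)
    fix f assume f: "f \<in> carrier R" "\<forall>g \<in> carrier R. \<phi> (f \<otimes>\<^bsub>R\<^esub> g) = \<zero>\<^bsub>K\<^esub>" "f \<noteq> \<zero>\<^bsub>R\<^esub>"
    then obtain q where q: "q \<in> Q" "f \<notin> q" using int by blast
    note qq = qi[OF q(1)] and m = R.maximal_idealD[OF R.primary_radical_maximal[OF prim[OF q(1)]]]
    obtain h where h: "h \<in> carrier R" "f \<otimes>\<^bsub>R\<^esub> h \<notin> q"
      "\<And>x. x \<in> ideal_radical R q \<Longrightarrow> x \<otimes>\<^bsub>R\<^esub> (f \<otimes>\<^bsub>R\<^esub> h) \<in> q"
      using R.socle_multiple_modulo_primary[OF prim[OF q(1)] f(1) q(2)] by metis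
    define n where "n = f \<otimes>\<^bsub>R\<^esub> h"
    have n: "n \<in> carrier R" "n \<notin> q" using f h by (auto simp: n_def)
    obtain r where r: "r \<in> carrier R" "n \<ominus>\<^bsub>R\<^esub> r \<otimes>\<^bsub>R\<^esub> s q \<in> q"
      using gen[OF q(1) n(1)] h(3) unfolding n_def by blast
    \<comment> \<open>Elements of the radical send the socle generator into \<open>q\<close>,
      whereas \<open>n\<close> is outside \<open>q\<close>. Hence \<open>r\<close> is a unit modulo
      \<open>q\<close>, and its inverse \<open>b\<close> recovers the generator from
      \<open>n\<close>.\<close>
    have "r \<notin> ideal_radical R q"
    proof
      assume "r \<in> ideal_radical R q"
      then have "(n \<ominus>\<^bsub>R\<^esub> r \<otimes>\<^bsub>R\<^esub> s q) \<oplus>\<^bsub>R\<^esub> r \<otimes>\<^bsub>R\<^esub> s q \<in> q"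
        using R.ideal_closed(3)[OF qq r(2) sM[OF q(1)]] by blast
      then show False using n r(1) s(1)[OF q(1)] by (simp add: a_minus_def R.a_assoc R.l_neg)
    qed
    then obtain b where b: "b \<in> carrier R" "\<one>\<^bsub>R\<^esub> \<ominus>\<^bsub>R\<^esub> r \<otimes>\<^bsub>R\<^esub> b \<in> q"
      using R.unit_modulo_primary[OF prim[OF q(1)] r(1)] by metis
    let ?e = "e q" and ?s = "s q"
    note ec = e[OF q(1)] and sc = s(1)[OF q(1)]
    have ee: "?e \<otimes>\<^bsub>R\<^esub> (?e \<otimes>\<^bsub>R\<^esub> x) = ?e \<otimes>\<^bsub>R\<^esub> x" if x: "x \<in> carrier R" for x
    proof -
      have "(\<one>\<^bsub>R\<^esub> \<ominus>\<^bsub>R\<^esub> ?e) \<otimes>\<^bsub>R\<^esub> x \<in> q" using R.ideal_closed(6)[OF qq e1[OF q(1)] x] .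
      then have "?e \<otimes>\<^bsub>R\<^esub> ((\<one>\<^bsub>R\<^esub> \<ominus>\<^bsub>R\<^esub> ?e) \<otimes>\<^bsub>R\<^esub> x) = \<zero>\<^bsub>R\<^esub>" by (rule e0[OF q(1)])
      then have "?e \<otimes>\<^bsub>R\<^esub> x \<ominus>\<^bsub>R\<^esub> ?e \<otimes>\<^bsub>R\<^esub> (?e \<otimes>\<^bsub>R\<^esub> x) = \<zero>\<^bsub>R\<^esub>"
        using ec x by (simp add: a_minus_def R.l_distr R.r_distr R.l_minus R.r_minus)
      then show ?thesis using ec x by (metis R.m_closed R.r_right_minus_eq)
    qed
    have ens: "?e \<otimes>\<^bsub>R\<^esub> (b \<otimes>\<^bsub>R\<^esub> n) = ?e \<otimes>\<^bsub>R\<^esub> ?s"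
    proof -
      have "b \<otimes>\<^bsub>R\<^esub> (n \<ominus>\<^bsub>R\<^esub> r \<otimes>\<^bsub>R\<^esub> ?s) \<ominus>\<^bsub>R\<^esub> (\<one>\<^bsub>R\<^esub> \<ominus>\<^bsub>R\<^esub> r \<otimes>\<^bsub>R\<^esub> b) \<otimes>\<^bsub>R\<^esub> ?s \<in> q"
        using R.ideal_closed(4)[OF qq R.ideal_closed(5)[OF qq r(2) b(1)] R.ideal_closed(6)[OF qq b(2) sc]] .
      moreover have "b \<otimes>\<^bsub>R\<^esub> (n \<ominus>\<^bsub>R\<^esub> r \<otimes>\<^bsub>R\<^esub> ?s) \<ominus>\<^bsub>R\<^esub> (\<one>\<^bsub>R\<^esub> \<ominus>\<^bsub>R\<^esub> r \<otimes>\<^bsub>R\<^esub> b) \<otimes>\<^bsub>R\<^esub> ?s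
          = b \<otimes>\<^bsub>R\<^esub> n \<ominus>\<^bsub>R\<^esub> ?s"
        using b(1) n(1) r(1) sc by algebra
      ultimately have "?e \<otimes>\<^bsub>R\<^esub> (b \<otimes>\<^bsub>R\<^esub> n \<ominus>\<^bsub>R\<^esub> ?s) = \<zero>\<^bsub>R\<^esub>" using e0[OF q(1)] by simp
      then have "?e \<otimes>\<^bsub>R\<^esub> (b \<otimes>\<^bsub>R\<^esub> n) \<ominus>\<^bsub>R\<^esub> ?e \<otimes>\<^bsub>R\<^esub> ?s = \<zero>\<^bsub>R\<^esub>"
        using b(1) n(1) ec sc by (simp add: a_minus_def R.r_distr R.r_minus)
      then show ?thesis using b(1) n(1) ec sc by (metis R.m_closed R.r_right_minus_eq)
    qed
    \<comment> \<open>The multiplier is chosen so that \<open>f g\<close> is \<open>e q\<close>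
      times the socle generator, a point where only the summand of \<open>q\<close> survives and is
      nonzero.\<close>
    define g where "g = h \<otimes>\<^bsub>R\<^esub> (?e \<otimes>\<^bsub>R\<^esub> b)"
    have gc: "g \<in> carrier R" using h b ec by (simp add: g_def)
    have "f \<otimes>\<^bsub>R\<^esub> g = ?e \<otimes>\<^bsub>R\<^esub> (b \<otimes>\<^bsub>R\<^esub> n)"
      using f(1) h(1) b(1) ec by (simp add: g_def n_def R.m_ac)
    then have fg: "f \<otimes>\<^bsub>R\<^esub> g = ?e \<otimes>\<^bsub>R\<^esub> ?s" using ens by simp
    have other: "e p \<otimes>\<^bsub>R\<^esub> (?e \<otimes>\<^bsub>R\<^esub> ?s) = \<zero>\<^bsub>R\<^esub>" if p: "p \<in> Q" "p \<noteq> q" for p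
    proof -
      have "?e \<otimes>\<^bsub>R\<^esub> ?s \<in> p"
        using R.ideal_closed(6)[OF qi[OF p(1)] _ sc] eq'[OF q(1) p] by blast
      then show ?thesis by (rule e0[OF p(1)])
    qed
    have "\<phi> (f \<otimes>\<^bsub>R\<^esub> g) = (\<Oplus>\<^bsub>K\<^esub> p \<in> Q. if q = p then l p (e p \<otimes>\<^bsub>R\<^esub> ?s) else \<zero>\<^bsub>K\<^esub>)"
      unfolding \<phi>_def fg
    proof (rule K.finsum_cong')
      show "(\<lambda>p. if q = p then l p (e p \<otimes>\<^bsub>R\<^esub> ?s) else \<zero>\<^bsub>K\<^esub>) \<in> Q \<rightarrow> carrier K"
        using functionalD(1)[OF le sc] by auto
      show "l p (e p \<otimes>\<^bsub>R\<^esub> (?e \<otimes>\<^bsub>R\<^esub> ?s)) = (if q = p then l p (e p \<otimes>\<^bsub>R\<^esub> ?s) else \<zero>\<^bsub>K\<^esub>)"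
        if "p \<in> Q" for p
        using other[OF that] functional_zero[OF l(1)[OF that]] ee[OF sc] by auto
    qed simp
    also have "\<dots> = l q (e q \<otimes>\<^bsub>R\<^esub> ?s)"
      using functionalD(1)[OF le sc] q fin by (intro K.finsum_singleton) auto
    finally show False using l(2)[OF q(1)] f(2) gc by simp
  qed
  then show thesis using that \<phi> by blast
qed

end

section \<open>The canonical module and the equivalence\<close>

lemma canonical_module_simps:
  "carrier (canonical_module K R) = module_hom K R (self_module K) \<inter> extensional (carrier R)"
  "zero (canonical_module K R) = (\<lambda>g \<in> carrier R. \<zero>\<^bsub>K\<^esub>)"
  "add (canonical_module K R) = (\<lambda>\<phi> \<psi>. \<lambda>g \<in> carrier R. \<phi> g \<oplus>\<^bsub>K\<^esub> \<psi> g)"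
  "smult (canonical_module K R) = (\<lambda>f \<phi>. \<lambda>g \<in> carrier R. \<phi> (f \<otimes>\<^bsub>R\<^esub> g))"
  by (simp_all add: canonical_module_def)

context finite_dim_algebra
begin

text \<open>Restriction turns any functional into an element of the canonical module, whose members
  are extensional.\<close>

lemma functional_restrict:
  "p \<in> functionals \<Longrightarrow> restrict p (carrier R) \<in> functionals"
  by (rule functionalI) (simp_all add: functionalD)

lemma module_canonical_module: "Module.module R (canonical_module K R)"
proof (rule module_criteria, unfold canonical_module_simps)
  let ?C = "functionals \<inter> extensional (carrier R)"
  show "cring R" by (rule R.is_cring)
  have ext: "\<phi> = \<psi>" if "\<phi> \<in> ?C" "\<psi> \<in> ?C" "\<And>x. x \<in> carrier R \<Longrightarrow> \<phi> x = \<psi> x" for \<phi> \<psi>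
    using that by (auto intro: extensionalityI)
  have zero: "(\<lambda>g \<in> carrier R. \<zero>\<^bsub>K\<^esub>) \<in> ?C"
    by (auto intro!: functionalI)
  have add: "(\<lambda>g \<in> carrier R. \<phi> g \<oplus>\<^bsub>K\<^esub> \<psi> g) \<in> ?C" if "\<phi> \<in> ?C" "\<psi> \<in> ?C" for \<phi> \<psi>
    using that by (auto intro!: functionalI simp: functionalD K.a_ac K.r_distr)
  have smult: "(\<lambda>g \<in> carrier R. \<phi> (f \<otimes>\<^bsub>R\<^esub> g)) \<in> ?C" if "f \<in> carrier R" "\<phi> \<in> ?C" for f \<phi>
    using that functional_restrict[OF functional_translate] by auto
  have neg: "(\<lambda>g \<in> carrier R. \<ominus>\<^bsub>K\<^esub> \<phi> g) \<in> ?C" if "\<phi> \<in> ?C" for \<phi>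
    using that by (auto intro!: functionalI simp: functionalD K.minus_add K.r_minus)
  show "(\<lambda>g \<in> carrier R. \<zero>\<^bsub>K\<^esub>) \<in> ?C" by (rule zero)
  show "\<forall>\<phi> \<psi>. \<phi> \<in> ?C \<and> \<psi> \<in> ?C \<longrightarrow> (\<lambda>g \<in> carrier R. \<phi> g \<oplus>\<^bsub>K\<^esub> \<psi> g) \<in> ?C"
    using add by blast
  show "\<forall>f \<phi>. f \<in> carrier R \<and> \<phi> \<in> ?C \<longrightarrow> (\<lambda>g \<in> carrier R. \<phi> (f \<otimes>\<^bsub>R\<^esub> g)) \<in> ?C"
    using smult by blast
  show "\<forall>\<phi> \<in> ?C. \<exists>\<psi> \<in> ?C. (\<lambda>g \<in> carrier R. \<phi> g \<oplus>\<^bsub>K\<^esub> \<psi> g) = (\<lambda>g \<in> carrier R. \<zero>\<^bsub>K\<^esub>)"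
  proof
    fix \<phi> assume \<phi>: "\<phi> \<in> ?C"
    show "\<exists>\<psi> \<in> ?C. (\<lambda>g \<in> carrier R. \<phi> g \<oplus>\<^bsub>K\<^esub> \<psi> g) = (\<lambda>g \<in> carrier R. \<zero>\<^bsub>K\<^esub>)"
      by (rule bexI[OF _ neg[OF \<phi>]]) (use \<phi> in \<open>auto simp: functionalD K.r_neg cong: restrict_cong\<close>)
  qed
qed (auto simp: functionalD functional_zero K.a_ac R.m_ac R.l_distr R.r_distr
      intro: extensionalityI[of _ "carrier R"] cong: restrict_cong)

lemma cyclic_iff_generating:
  assumes \<phi>: "\<phi> \<in> carrier (canonical_module K R)"
  shows "carrier (canonical_module K R) =
      LinearCombinations.module.span R (canonical_module K R) {\<phi>} \<longleftrightarrow> generating \<phi>"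
    (is "carrier ?\<omega> = ?S \<longleftrightarrow> _")
proof -
  interpret W: Module.module R ?\<omega> by (rule module_canonical_module)
  have S: "?S = {f \<odot>\<^bsub>?\<omega>\<^esub> \<phi> | f. f \<in> carrier R}"
    by (rule W.span_singleton[OF \<phi>])
  have "carrier ?\<omega> = ?S \<longleftrightarrow> (\<forall>\<psi> \<in> carrier ?\<omega>. \<exists>f \<in> carrier R. \<psi> = f \<odot>\<^bsub>?\<omega>\<^esub> \<phi>)"
    unfolding S using W.smult_closed[OF _ \<phi>] by blast
  also have "\<dots> \<longleftrightarrow> generating \<phi>"
  proof
    assume *: "\<forall>\<psi> \<in> carrier ?\<omega>. \<exists>f \<in> carrier R. \<psi> = f \<odot>\<^bsub>?\<omega>\<^esub> \<phi>"
    show "generating \<phi>"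
      unfolding generating_def
    proof
      fix \<psi> assume "\<psi> \<in> functionals"
      then have "restrict \<psi> (carrier R) \<in> carrier ?\<omega>"
        by (simp add: canonical_module_simps functional_restrict)
      then obtain f where f: "f \<in> carrier R" "restrict \<psi> (carrier R) = f \<odot>\<^bsub>?\<omega>\<^esub> \<phi>"
        using * by blast
      have "\<psi> g = \<phi> (f \<otimes>\<^bsub>R\<^esub> g)" if "g \<in> carrier R" for g
        using fun_cong[OF f(2), of g] that by (simp add: canonical_module_simps)
      then show "\<exists>f \<in> carrier R. \<forall>g \<in> carrier R. \<psi> g = \<phi> (f \<otimes>\<^bsub>R\<^esub> g)" using f(1) by blast
    qed
  next
    assume gen: "generating \<phi>"
    show "\<forall>\<psi> \<in> carrier ?\<omega>. \<exists>f \<in> carrier R. \<psi> = f \<odot>\<^bsub>?\<omega>\<^esub> \<phi>"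
    proof
      fix \<psi> assume \<psi>: "\<psi> \<in> carrier ?\<omega>"
      then obtain f where f: "f \<in> carrier R" "\<And>g. g \<in> carrier R \<Longrightarrow> \<psi> g = \<phi> (f \<otimes>\<^bsub>R\<^esub> g)"
        using gen unfolding generating_def canonical_module_simps by blast
      have "\<psi> = f \<odot>\<^bsub>?\<omega>\<^esub> \<phi>"
        by (rule extensionalityI[of _ "carrier R"]) (use \<psi> f in \<open>auto simp: canonical_module_simps\<close>)
      then show "\<exists>f \<in> carrier R. \<psi> = f \<odot>\<^bsub>?\<omega>\<^esub> \<phi>" using f(1) by blast
    qed
  qed
  finally show ?thesis .
qed

lemma annihilator_zero_iff_nondegenerate:
  assumes \<phi>: "\<phi> \<in> carrier (canonical_module K R)"
  shows "annihilator R (canonical_module K R) \<phi> = {\<zero>\<^bsub>R\<^esub>} \<longleftrightarrow> nondegenerate \<phi>"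
proof -
  have \<phi>f: "\<phi> \<in> functionals" using \<phi> by (simp add: canonical_module_simps)
  have eq: "(\<lambda>g \<in> carrier R. \<phi> (f \<otimes>\<^bsub>R\<^esub> g)) = (\<lambda>g \<in> carrier R. \<zero>\<^bsub>K\<^esub>) \<longleftrightarrow>
      (\<forall>g \<in> carrier R. \<phi> (f \<otimes>\<^bsub>R\<^esub> g) = \<zero>\<^bsub>K\<^esub>)" for f
    by (auto simp: fun_eq_iff restrict_def)
  have "annihilator R (canonical_module K R) \<phi> =
      {f \<in> carrier R. \<forall>g \<in> carrier R. \<phi> (f \<otimes>\<^bsub>R\<^esub> g) = \<zero>\<^bsub>K\<^esub>}"
    unfolding annihilator_def canonical_module_simps eq ..
  moreover have "\<forall>g \<in> carrier R. \<phi> (\<zero>\<^bsub>R\<^esub> \<otimes>\<^bsub>R\<^esub> g) = \<zero>\<^bsub>K\<^esub>"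
    using functional_zero[OF \<phi>f] by simp
  ultimately show ?thesis
    unfolding nondegenerate_def using R.zero_closed by (simp only: set_eq_iff) blast
qed

theorem gorenstein_criterion:
  fixes \<omega> defines "\<omega> \<equiv> canonical_module K R"
  shows "locally_gorenstein R \<longleftrightarrow>
      (\<exists>\<phi> \<in> carrier \<omega>. carrier \<omega> = LinearCombinations.module.span R \<omega> {\<phi>})"
    and "(\<exists>\<phi> \<in> carrier \<omega>. carrier \<omega> = LinearCombinations.module.span R \<omega> {\<phi>}) \<longleftrightarrow>
      (\<exists>\<phi> \<in> carrier \<omega>. annihilator R \<omega> \<phi> = {\<zero>\<^bsub>R\<^esub>})"
proof -
  have \<omega>: "\<phi> \<in> carrier \<omega> \<Longrightarrow> \<phi> \<in> functionals" for \<phi>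
    by (simp add: \<omega>_def canonical_module_simps)
  \<comment> \<open>Existence of a nondegenerate functional is the hub to which each of the three
    conditions is compared.\<close>
  have cyclic: "(\<exists>\<phi> \<in> carrier \<omega>. carrier \<omega> = LinearCombinations.module.span R \<omega> {\<phi>}) \<longleftrightarrow>
      (\<exists>\<phi> \<in> carrier \<omega>. nondegenerate \<phi>)"
    using cyclic_iff_generating generating_of_nondegenerate[OF \<omega>] nondegenerate_of_generating
    unfolding \<omega>_def by blast
  show "(\<exists>\<phi> \<in> carrier \<omega>. carrier \<omega> = LinearCombinations.module.span R \<omega> {\<phi>}) \<longleftrightarrow>
      (\<exists>\<phi> \<in> carrier \<omega>. annihilator R \<omega> \<phi> = {\<zero>\<^bsub>R\<^esub>})"
    unfolding cyclic using annihilator_zero_iff_nondegenerate unfolding \<omega>_def by blast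
  have "\<exists>\<phi> \<in> carrier \<omega>. nondegenerate \<phi>" if "locally_gorenstein R"
  proof -
    obtain \<phi> where \<phi>: "\<phi> \<in> functionals" "nondegenerate \<phi>"
      using nondegenerate_of_locally_gorenstein \<open>locally_gorenstein R\<close> by blast
    \<comment> \<open>Nondegeneracy evaluates the functional only at products in \<open>R\<close>,
      so restriction preserves it.\<close>
    have "nondegenerate (restrict \<phi> (carrier R))"
      using \<phi>(2) unfolding nondegenerate_def by simp
    moreover have "restrict \<phi> (carrier R) \<in> carrier \<omega>"
      using functional_restrict[OF \<phi>(1)] by (simp add: \<omega>_def canonical_module_simps)
    ultimately show ?thesis by blast
  qed
  then show "locally_gorenstein R \<longleftrightarrow>
      (\<exists>\<phi> \<in> carrier \<omega>. carrier \<omega> = LinearCombinations.module.span R \<omega> {\<phi>})"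
    unfolding cyclic using locally_gorenstein_of_nondegenerate \<omega> by blast
qed

end

section \<open>Affine algebras\<close>

text \<open>The case needed is \<open>affine_algebra\<close>, where a scalar acts through
  multiplication by the class of a constant polynomial; \<open>h\<close> is the structure map from
  the ground field to the quotient.\<close>

lemma algebra_extend:
  assumes "cring K" "cring S" and h: "h \<in> ring_hom K S"
  shows "algebra K (ring.extend S (module.fields (\<lambda>c x. h c \<otimes>\<^bsub>S\<^esub> x)))"
proof -
  interpret K: cring K by fact
  interpret S: cring S by fact
  note h = ring_hom_closed[OF h] ring_hom_add[OF h] ring_hom_mult[OF h] ring_hom_one[OF h]
  let ?M = "ring.extend S (module.fields (\<lambda>c x. h c \<otimes>\<^bsub>S\<^esub> x))"
  have simps: "carrier ?M = carrier S" "monoid.mult ?M = monoid.mult S" "one ?M = one S"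
    "zero ?M = zero S" "add ?M = add S" "smult ?M = (\<lambda>c x. h c \<otimes>\<^bsub>S\<^esub> x)"
    by (simp_all add: ring.defs module.defs)
  have "cring ?M"
    by (intro cringI abelian_groupI comm_monoidI; unfold simps)
      (auto simp: S.a_ac S.m_ac S.l_distr S.r_distr intro: S.l_neg bexI[of _ "\<ominus>\<^bsub>S\<^esub> _"])
  then show ?thesis
    by (intro algebraI; (unfold simps)?)
      (auto simp: h S.l_distr S.r_distr S.m_assoc intro: K.is_cring)
qed

lemma cring_of_type_subset:
  fixes C :: "'a::comm_ring_1 set"
  assumes "0 \<in> C" "1 \<in> C" and neg: "\<And>x. x \<in> C \<Longrightarrow> - x \<in> C"
    and "\<And>x y. x \<in> C \<Longrightarrow> y \<in> C \<Longrightarrow> x + y \<in> C" "\<And>x y. x \<in> C \<Longrightarrow> y \<in> C \<Longrightarrow> x * y \<in> C"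
  shows "cring (ring_of_type_algebra\<lparr>carrier := C\<rparr>)"
proof -
  let ?R = "ring_of_type_algebra\<lparr>carrier := C\<rparr>"
  have simps: "carrier ?R = C" "monoid.mult ?R = (*)" "one ?R = 1" "zero ?R = 0" "add ?R = (+)"
    by (simp_all add: ring_of_type_algebra_def)
  have "\<exists>y \<in> C. y + x = 0" if "x \<in> C" for x
    by (rule bexI[OF _ neg[OF that]]) simp
  then show ?thesis
    by (intro cringI abelian_groupI comm_monoidI; unfold simps)
      (use assms in \<open>simp_all add: algebra_simps\<close>)
qed

lemma cring_mpoly_ring: "cring (mpoly_ring n :: 'k::field mpoly ring)"
  unfolding mpoly_ring_def
proof (rule cring_of_type_subset)
  let ?C = "{p :: 'k mpoly. \<forall>m \<in> Poly_Mapping.keys p. Poly_Mapping.keys m \<subseteq> {..<n}}"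
  fix p q assume p: "p \<in> ?C" and q: "q \<in> ?C"
  show "p + q \<in> ?C"
    using p q Poly_Mapping.keys_add[of p q] by blast
  show "p * q \<in> ?C"
  proof (intro CollectI ballI)
    fix m assume "m \<in> Poly_Mapping.keys (p * q)"
    then obtain a b where "m = a + b" "a \<in> Poly_Mapping.keys p" "b \<in> Poly_Mapping.keys q"
      using keys_mult[of p q] by blast
    then show "Poly_Mapping.keys m \<subseteq> {..<n}"
      using p q Poly_Mapping.keys_add[of a b] by blast
  qed
qed auto

lemma constant_ring_hom: "Poly_Mapping.single 0 \<in> ring_hom ground_field (mpoly_ring n)"
  by (rule ring_hom_memI)
    (auto simp: mpoly_ring_def ring_of_type_algebra_def single_add mult_single)

lemma algebra_affine_algebra:
  assumes "ideal I (mpoly_ring n)"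
  shows "algebra ground_field (affine_algebra n I)"
proof -
  interpret P: cring "mpoly_ring n" by (rule cring_mpoly_ring)
  interpret I: ideal I "mpoly_ring n" by fact
  have "(\<lambda>c. I +>\<^bsub>mpoly_ring n\<^esub> Poly_Mapping.single 0 c) \<in> ring_hom ground_field (mpoly_ring n Quot I)"
    using ring_hom_trans[OF constant_ring_hom I.rcos_ring_hom] by (simp add: comp_def)
  then show ?thesis
    unfolding affine_algebra_def
    by (intro algebra_extend cring_from_type_algebra I.quotient_is_cring P.is_cring)
qed

theorem theorem5p2:
  fixes R :: "('k::field, 'k mpoly set) module"
  assumes "zero_dim_affine_algebra R"
  defines "\<omega> \<equiv> canonical_module ground_field R"
  shows "(locally_gorenstein R \<longleftrightarrow> (\<exists>\<phi> \<in> carrier \<omega>. carrier \<omega> = LinearCombinations.module.span R \<omega> {\<phi>}))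
       \<and> ((\<exists>\<phi> \<in> carrier \<omega>. carrier \<omega> = LinearCombinations.module.span R \<omega> {\<phi>})
            \<longleftrightarrow> (\<exists>\<phi> \<in> carrier \<omega>. annihilator R \<omega> \<phi> = {\<zero>\<^bsub>R\<^esub>}))"
proof -
  obtain n I where "ideal I (mpoly_ring n)" "R = affine_algebra n I"
    and fin: "vectorspace.fin_dim ground_field R"
    using assms(1) unfolding zero_dim_affine_algebra_def by blast
  then have "algebra ground_field R"
    using algebra_affine_algebra by blast
  then interpret finite_dim_algebra ground_field R
    by (rule finite_dim_algebra.intro[OF field_from_type_algebra _ fin])
  show ?thesis
    unfolding \<omega>_def by (intro conjI gorenstein_criterion)
qed

end
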